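(* Let $M$ be a Hopf hypersurface of the homogeneous nearly K\"ahler $\mathbf{S}^3\times\mathbf{S}^3$ with three distinct principal curvatures and satisfying $P\{U\}^\perp=\{U\}^\perp$. If $P\xi=\tfrac12\xi+\tfrac{\sqrt3}{2}J\xi$, then, up to isometries of type $\mathcal{F}_{abc}$, $M$ is locally (an open part of) the image of the embedding $f_r:\mathbf{S}^3\times\mathbf{S}^2\to\mathbf{S}^3\times\mathbf{S}^3$, $f_r(x,y)=(x,\sqrt{1-r^2}+ry)$, for some $0<r\le1$.
   Context: Regard $\mathbf{S}^3$ as unit quaternions and $\mathbf{S}^2$ as unit imaginary quaternions in $\mathbb{H}$; write tangent vectors at $(p,q)$ as $Z=(U,V)$. The homogeneous NK structure: $JZ=\tfrac{1}{\sqrt3}(2pq^{-1}V-U,\,-2qp^{-1}U+V)$, $g(Z,Z')=\tfrac43(\langle U,U'\rangle+\langle V,V'\rangle)-\tfrac23(\langle p^{-1}U,q^{-1}V'\rangle+\langle p^{-1}U',q^{-1}V\rangle)$; almost product structure $PZ=(pq^{-1}V,qp^{-1}U)$. For unit quaternions $a,b,c$, $\mathcal{F}_{abc}(p,q)=(ap\bar c,bq\bar c)$ is an isometry. For a connected orientable hypersurface $M$ with unit normal $\xi$ and shape operator $A$, $U=-J\xi$; $M$ is Hopf if the integral curves of $U$ are geodesics (equivalently $AU=\alpha U$). $\{U\}^\perp$ is the distribution of tangent vectors orthogonal to $U$. "Three distinct principal curvatures" means $A$ has exactly three distinct eigenvalues at every point. *)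

theory Defs
  imports "HOL-Analysis.Analysis"
begin

section \<open>Quaternions, modelled as complex pairs (Cayley--Dickson): (z,w) = z + w j\<close>

type_synonym quat = "complex \<times> complex"

definition qmult :: "quat \<Rightarrow> quat \<Rightarrow> quat" (infixl "\<odot>" 70) where
  "qmult x y = (fst x * fst y - snd x * cnj (snd y), fst x * snd y + snd x * cnj (fst y))"

definition qcnj :: "quat \<Rightarrow> quat" where
  "qcnj x = (cnj (fst x), - snd x)"

definition qinv :: "quat \<Rightarrow> quat" where
  "qinv x = (inverse ((norm x)\<^sup>2)) *\<^sub>R qcnj x"

definition qreal :: "real \<Rightarrow> quat" where
  "qreal r = (complex_of_real r, 0)"

definition qRe :: "quat \<Rightarrow> real" where
  "qRe x = Re (fst x)"

text \<open>Unit quaternions S^3 and unit imaginary quaternions S^2. The inner product and norm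
  on complex \<times> complex are the Euclidean ones of R^4.\<close>

definition S3 :: "quat set" where "S3 = sphere 0 1"
definition S2 :: "quat set" where "S2 = {y. norm y = 1 \<and> qRe y = 0}"

type_synonym pt = "quat \<times> quat"

definition S3S3 :: "pt set" where "S3S3 = S3 \<times> S3"

definition TS :: "pt \<Rightarrow> pt set" where
  "TS x = {Z. inner (fst x) (fst Z) = 0 \<and> inner (snd x) (snd Z) = 0}"

definition NKJ :: "pt \<Rightarrow> pt \<Rightarrow> pt" where
  "NKJ x Z = (let p = fst x; q = snd x; U = fst Z; V = snd Z in
     (1 / sqrt 3) *\<^sub>R (2 *\<^sub>R (p \<odot> qinv q \<odot> V) - U, - 2 *\<^sub>R (q \<odot> qinv p \<odot> U) + V))"

text \<open>The metric g. The formula is written for arbitrary points (p,q) with p,q nonzero, so that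
  it defines a Riemannian metric on a neighbourhood of S^3 x S^3 in R^8 extending g; on
  tangent vectors of S^3 x S^3 it is exactly the g of the paper.\<close>
definition NKg :: "pt \<Rightarrow> pt \<Rightarrow> pt \<Rightarrow> real" where
  "NKg x Z Z' = (let p = fst x; q = snd x in
     4/3 * (inner (fst Z) (fst Z') + inner (snd Z) (snd Z'))
     - 2/3 * (inner (qinv p \<odot> fst Z) (qinv q \<odot> snd Z') + inner (qinv p \<odot> fst Z') (qinv q \<odot> snd Z)))"

definition NKP :: "pt \<Rightarrow> pt \<Rightarrow> pt" where
  "NKP x Z = (fst x \<odot> qinv (snd x) \<odot> snd Z, snd x \<odot> qinv (fst x) \<odot> fst Z)"

definition Fabc :: "quat \<Rightarrow> quat \<Rightarrow> quat \<Rightarrow> pt \<Rightarrow> pt" where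
  "Fabc a b c x = (a \<odot> fst x \<odot> qcnj c, b \<odot> snd x \<odot> qcnj c)"

definition f_emb :: "real \<Rightarrow> pt \<Rightarrow> pt" where
  "f_emb r xy = (fst xy, qreal (sqrt (1 - r\<^sup>2)) + r *\<^sub>R snd xy)"

fun iter_dderiv :: "('a::real_normed_vector \<Rightarrow> 'b::real_normed_vector) \<Rightarrow> 'a list \<Rightarrow> 'a \<Rightarrow> 'b" where
  "iter_dderiv f [] = f"
| "iter_dderiv f (v # vs) = (\<lambda>x. frechet_derivative (iter_dderiv f vs) (at x) v)"

definition smooth_on :: "'a::real_normed_vector set \<Rightarrow> ('a \<Rightarrow> 'b::real_normed_vector) \<Rightarrow> bool" where
  "smooth_on S f \<longleftrightarrow> open S \<and> (\<forall>vs. \<forall>x\<in>S. iter_dderiv f vs differentiable (at x))"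

definition submanifold5 :: "pt set \<Rightarrow> bool" where
  "submanifold5 M \<longleftrightarrow> (\<forall>m\<in>M. \<exists>W (F :: pt \<Rightarrow> real^3). m \<in> W \<and> smooth_on W F \<and>
      M \<inter> W = {y\<in>W. F y = 0} \<and>
      (\<forall>y\<in>M \<inter> W. surj (frechet_derivative F (at y))))"

definition tangent_space :: "pt set \<Rightarrow> pt \<Rightarrow> pt set" where
  "tangent_space M m = {v. \<exists>e>0. \<exists>\<gamma>. \<gamma> 0 = m \<and> \<gamma> ` {-e<..<e} \<subseteq> M \<and>
                                 (\<gamma> has_vector_derivative v) (at 0)}"

definition dg :: "pt \<Rightarrow> pt \<Rightarrow> pt \<Rightarrow> pt \<Rightarrow> real" where
  "dg x X Y Z = frechet_derivative (\<lambda>y. NKg y Y Z) (at x) X"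

text \<open>Christoffel term (Koszul formula): \<nabla>_X Y = DY(X) + Gamma_x(X,Y) for the ambient
  Levi-Civita connection of the (extended) metric g on a neighbourhood of S^3 x S^3.\<close>
definition Gamma :: "pt \<Rightarrow> pt \<Rightarrow> pt \<Rightarrow> pt" where
  "Gamma x X Y = (THE w. \<forall>Z. NKg x w Z = (dg x X Y Z + dg x Y X Z - dg x Z X Y) / 2)"

definition covd :: "pt \<Rightarrow> (pt \<Rightarrow> pt) \<Rightarrow> pt \<Rightarrow> pt" where
  "covd x Y X = frechet_derivative Y (at x) X + Gamma x X (Y x)"

definition tproj :: "pt set \<Rightarrow> pt \<Rightarrow> pt \<Rightarrow> pt" where
  "tproj M m v = (THE w. w \<in> tangent_space M m \<and> (\<forall>Z\<in>tangent_space M m. NKg m (v - w) Z = 0))"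

text \<open>Shape operator A X = - (tilde\<nabla>_X xi)^T. Tangential projection of the ambient connection
  equals the tangential part of the Levi-Civita connection of S^3 x S^3 (Gauss formula).\<close>
definition shape_op :: "pt set \<Rightarrow> (pt \<Rightarrow> pt) \<Rightarrow> pt \<Rightarrow> pt \<Rightarrow> pt" where
  "shape_op M \<xi> m X = - tproj M m (covd m \<xi> X)"

definition principal_curvatures :: "pt set \<Rightarrow> (pt \<Rightarrow> pt) \<Rightarrow> pt \<Rightarrow> real set" where
  "principal_curvatures M \<xi> m =
     {k. \<exists>X\<in>tangent_space M m. X \<noteq> 0 \<and> shape_op M \<xi> m X = k *\<^sub>R X}"

definition hypersurface_with_normal :: "pt set \<Rightarrow> (pt \<Rightarrow> pt) \<Rightarrow> bool" where
  "hypersurface_with_normal M \<xi> \<longleftrightarrow>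
     M \<subseteq> S3S3 \<and> submanifold5 M \<and> connected M \<and> M \<noteq> {} \<and>
     (\<exists>N. M \<subseteq> N \<and> smooth_on N \<xi>) \<and>
     (\<forall>m\<in>M. \<xi> m \<in> TS m \<and> NKg m (\<xi> m) (\<xi> m) = 1 \<and>
              (\<forall>X\<in>tangent_space M m. NKg m (\<xi> m) X = 0))"

definition Ufield :: "(pt \<Rightarrow> pt) \<Rightarrow> pt \<Rightarrow> pt" where
  "Ufield \<xi> m = - NKJ m (\<xi> m)"

definition is_Hopf :: "pt set \<Rightarrow> (pt \<Rightarrow> pt) \<Rightarrow> bool" where
  "is_Hopf M \<xi> \<longleftrightarrow> (\<forall>m\<in>M. \<exists>\<alpha>. shape_op M \<xi> m (Ufield \<xi> m) = \<alpha> *\<^sub>R Ufield \<xi> m)"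

definition Uperp :: "pt set \<Rightarrow> (pt \<Rightarrow> pt) \<Rightarrow> pt \<Rightarrow> pt set" where
  "Uperp M \<xi> m = {X\<in>tangent_space M m. NKg m X (Ufield \<xi> m) = 0}"

end

theory Submission
  imports Defs
begin

text \<open>
  Write \<open>N\<close> for the second component of \<open>\<xi>\<close> at \<open>(p, q)\<close>. The hypothesis on \<open>P\<xi>\<close> says that the
  first component is \<open>p q\<^sup>-\<^sup>1 N / 2\<close>; then \<open>|N| = 1\<close> and \<open>g(\<xi>, X) = N \<bullet> X\<^sub>2\<close>, so the tangent space of
  \<open>M\<close> is the set of all \<open>(X\<^sub>1, X\<^sub>2)\<close> with \<open>X\<^sub>1 \<bottom> p\<close> and \<open>X\<^sub>2 \<bottom> q, N\<close>. Locally \<open>M\<close> is therefore a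
  product of \<open>S\<^sup>3\<close> with a surface in \<open>S\<^sup>3\<close> that has unit normal \<open>N\<close>. An eigenvalue \<open>\<mu>\<close> of the
  shape operator of that surface produces the two principal curvatures \<open>\<lambda>\<close> of \<open>M\<close> with
  \<open>\<lambda>\<^sup>2 - \<mu> \<lambda> - 1/12 = 0\<close>, and different \<open>\<mu>\<close> give different \<open>\<lambda>\<close>; so two distinct \<open>\<mu>\<close> would give four
  principal curvatures. Hence the surface is umbilic, \<open>dN(X) = - h X\<^sub>2\<close>; the Codazzi argument shows
  that \<open>h\<close> is locally constant, so \<open>N + h q\<close> is a locally constant vector \<open>C\<close>, and \<open>q\<close> lies on the
  small sphere \<open>q \<bullet> C = h\<close>, which a left multiplication turns into \<open>Re q = |h| / sqrt (1 + h\<^sup>2)\<close>.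
\<close>

section \<open>Second derivatives and zero sets\<close>

text \<open>The mean value theorem, applied in the direction \<open>v\<close> to a difference of two
  values of \<open>f\<close>, turns the second difference into \<open>s\<close> times a difference
  of two values of the directional derivative. Both are compared with its linearisation at
  \<open>x\<close>, so differentiability of that directional derivative at the single point
  \<open>x\<close> suffices.\<close>

lemma second_difference_estimate:
  fixes f :: "'a::real_normed_vector \<Rightarrow> real"
  assumes "open W" "x \<in> W" and df: "\<And>y. y \<in> W \<Longrightarrow> f differentiable (at y)"
    and D: "((\<lambda>y. frechet_derivative f (at y) v) has_derivative D) (at x)"
    and "e > 0"
  shows "\<exists>d>0. \<forall>s. 0 < s \<and> s < d \<longrightarrow>
    \<bar>f (x + s *\<^sub>R u + s *\<^sub>R v) - f (x + s *\<^sub>R u) - f (x + s *\<^sub>R v) + f x - s\<^sup>2 * D u\<bar>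
      \<le> e * s\<^sup>2 * (norm u + 2 * norm v)"
proof -
  let ?g = "\<lambda>y. frechet_derivative f (at y) v"
  interpret D: bounded_linear D using D by (rule has_derivative_bounded_linear)
  obtain d1 where d1: "d1 > 0" "\<And>y. norm (y - x) < d1 \<Longrightarrow> norm (?g y - ?g x - D (y - x)) \<le> e * norm (y - x)"
    using D \<open>e > 0\<close> unfolding has_derivative_at_alt by blast
  obtain d2 where d2: "d2 > 0" "ball x d2 \<subseteq> W"
    using \<open>open W\<close> \<open>x \<in> W\<close> open_contains_ball by blast
  \<comment> \<open>For 0 < s < d every point sampled below lies within \<open>s * K\<close> of
    \<open>x\<close>, hence within both radii \<open>d1\<close> and \<open>d2\<close>.\<close>
  define K where "K = norm u + norm v + 1"
  have K: "K > 0" unfolding K_def by (simp add: add_nonneg_pos)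
  define d where "d = min d1 d2 / K"
  have dpos: "d > 0" using K d1 d2 by (simp add: d_def)
  have near: "norm (s *\<^sub>R (c *\<^sub>R u) + \<theta> *\<^sub>R v) < min d1 d2"
    if "0 < s" "s < d" "0 \<le> \<theta>" "\<theta> \<le> s" "c = 0 \<or> c = 1" for s \<theta> c :: real
  proof -
    have "norm (s *\<^sub>R (c *\<^sub>R u) + \<theta> *\<^sub>R v) \<le> s * norm u + \<theta> * norm v"
      using that by (intro order_trans[OF norm_triangle_ineq]) auto
    also have "\<dots> \<le> s * norm u + s * norm v"
      using that by (simp add: mult_right_mono)
    also have "\<dots> < s * K" using that by (simp add: K_def algebra_simps)
    also have "\<dots> < d * K" using that K by simp
    also have "\<dots> = min d1 d2" using K by (simp add: d_def)
    finally show ?thesis .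
  qed
  have "\<bar>f (x + s *\<^sub>R u + s *\<^sub>R v) - f (x + s *\<^sub>R u) - f (x + s *\<^sub>R v) + f x - s\<^sup>2 * D u\<bar>
      \<le> e * s\<^sup>2 * (norm u + 2 * norm v)" if s: "0 < s" "s < d" for s
  proof -
    define \<phi> where "\<phi> = (\<lambda>\<theta>. f (x + s *\<^sub>R u + \<theta> *\<^sub>R v) - f (x + \<theta> *\<^sub>R v))"
    have inW: "x + s *\<^sub>R (c *\<^sub>R u) + \<theta> *\<^sub>R v \<in> W" if "0 \<le> \<theta>" "\<theta> \<le> s" "c = 0 \<or> c = 1" for \<theta> c
    proof -
      have "dist (x + (s *\<^sub>R (c *\<^sub>R u) + \<theta> *\<^sub>R v)) x < d2"
        using near[OF s that] by (simp add: dist_norm)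
      then show ?thesis using d2(2) by (auto simp: add.assoc dist_commute)
    qed
    have der1: "((\<lambda>\<theta>. f (y + \<theta> *\<^sub>R v)) has_real_derivative ?g (y + \<theta> *\<^sub>R v)) (at \<theta>)"
      if "y + \<theta> *\<^sub>R v \<in> W" for y \<theta>
    proof -
      have 1: "(f has_derivative frechet_derivative f (at (y + \<theta> *\<^sub>R v))) (at (y + \<theta> *\<^sub>R v))"
        using df[OF that] frechet_derivative_works by blast
      have "((\<lambda>\<theta>. y + \<theta> *\<^sub>R v) has_derivative (\<lambda>t. t *\<^sub>R v)) (at \<theta>)"
        by (auto intro!: derivative_eq_intros)
      from has_derivative_compose[OF this 1]
      have "((\<lambda>\<theta>. f (y + \<theta> *\<^sub>R v)) has_derivative (\<lambda>t. frechet_derivative f (at (y + \<theta> *\<^sub>R v)) (t *\<^sub>R v))) (at \<theta>)" .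
      moreover have "(\<lambda>t. frechet_derivative f (at (y + \<theta> *\<^sub>R v)) (t *\<^sub>R v)) = (*) (?g (y + \<theta> *\<^sub>R v))"
        using linear_cmul[OF has_derivative_linear[OF 1]] by (auto simp: mult.commute)
      ultimately show ?thesis by (simp add: has_field_derivative_def)
    qed
    have "(\<phi> has_real_derivative (?g (x + s *\<^sub>R u + \<theta> *\<^sub>R v) - ?g (x + \<theta> *\<^sub>R v))) (at \<theta>)"
      if "0 \<le> \<theta>" "\<theta> \<le> s" for \<theta>
      unfolding \<phi>_def using inW[OF that, of 0] inW[OF that, of 1]
      by (intro DERIV_diff der1) auto
    from MVT2[OF s(1) this] obtain \<theta> where \<theta>: "0 < \<theta>" "\<theta> < s"
      "\<phi> s - \<phi> 0 = (s - 0) * (?g (x + s *\<^sub>R u + \<theta> *\<^sub>R v) - ?g (x + \<theta> *\<^sub>R v))"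
      by blast
    let ?h1 = "s *\<^sub>R u + \<theta> *\<^sub>R v" and ?h2 = "\<theta> *\<^sub>R v"
    have e1: "\<bar>?g (x + ?h1) - ?g x - D ?h1\<bar> \<le> e * norm ?h1"
      using d1(2)[of "x + ?h1"] near[OF s, of \<theta> 1] \<theta> by auto
    have e2: "\<bar>?g (x + ?h2) - ?g x - D ?h2\<bar> \<le> e * norm ?h2"
      using d1(2)[of "x + ?h2"] near[OF s, of \<theta> 0] \<theta> by auto
    have n1: "norm ?h1 \<le> s * norm u + s * norm v"
      using \<theta> s by (intro order_trans[OF norm_triangle_ineq]) (auto intro: mult_right_mono)
    have n2: "norm ?h2 \<le> s * norm v" using \<theta> by (auto intro: mult_right_mono)
    have D12: "D ?h1 = s * D u + D ?h2" by (simp add: D.add D.scaleR)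
    have "\<bar>?g (x + ?h1) - ?g (x + ?h2) - s * D u\<bar> \<le> e * norm ?h1 + e * norm ?h2"
      using e1 e2 D12 by linarith
    also have "\<dots> \<le> e * (s * norm u + s * norm v) + e * (s * norm v)"
      using n1 n2 \<open>e > 0\<close> by (intro add_mono mult_left_mono) auto
    also have "\<dots> = e * s * (norm u + 2 * norm v)" by (simp add: algebra_simps)
    finally have *: "\<bar>?g (x + ?h1) - ?g (x + ?h2) - s * D u\<bar> \<le> e * s * (norm u + 2 * norm v)" .
    have "f (x + s *\<^sub>R u + s *\<^sub>R v) - f (x + s *\<^sub>R u) - f (x + s *\<^sub>R v) + f x - s\<^sup>2 * D u
        = s * (?g (x + ?h1) - ?g (x + ?h2) - s * D u)"
      using \<theta>(3) by (simp add: \<phi>_def algebra_simps power2_eq_square)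
    then have "\<bar>f (x + s *\<^sub>R u + s *\<^sub>R v) - f (x + s *\<^sub>R u) - f (x + s *\<^sub>R v) + f x - s\<^sup>2 * D u\<bar>
        = s * \<bar>?g (x + ?h1) - ?g (x + ?h2) - s * D u\<bar>"
      using s by (simp add: abs_mult)
    also have "\<dots> \<le> s * (e * s * (norm u + 2 * norm v))"
      using * s by (intro mult_left_mono) auto
    also have "\<dots> = e * s\<^sup>2 * (norm u + 2 * norm v)" by (simp add: power2_eq_square)
    finally show ?thesis .
  qed
  then show ?thesis using dpos by blast
qed

text \<open>Young's form of the Schwarz theorem: the second difference is symmetric in
  \<open>u\<close> and \<open>v\<close>, so its two leading coefficients agree. Continuity of the
  second derivatives is not assumed.\<close>

lemma symmetric_second_derivative_real:
  fixes f :: "'a::real_normed_vector \<Rightarrow> real"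
  assumes W: "open W" "x \<in> W" and df: "\<And>y. y \<in> W \<Longrightarrow> f differentiable (at y)"
    and Dv: "((\<lambda>y. frechet_derivative f (at y) v) has_derivative Dv) (at x)"
    and Du: "((\<lambda>y. frechet_derivative f (at y) u) has_derivative Du) (at x)"
  shows "Dv u = Du v"
proof (rule ccontr)
  assume "Dv u \<noteq> Du v"
  define c where "c = \<bar>Dv u - Du v\<bar>"
  have c: "c > 0" using \<open>Dv u \<noteq> Du v\<close> by (simp add: c_def)
  \<comment> \<open>The two errors add up to e s^2 (K - 1); the summand 1 keeps \<open>K\<close>
    positive and makes the final inequality strict.\<close>
  define K where "K = 3 * (norm u + norm v) + 1"
  have K: "K > 0" unfolding K_def by (simp add: add_nonneg_pos)
  define e where "e = c / K"
  have e: "e > 0" using c K by (simp add: e_def)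
  obtain d1 where d1: "d1 > 0" "\<And>s. 0 < s \<and> s < d1 \<Longrightarrow>
    \<bar>f (x + s *\<^sub>R u + s *\<^sub>R v) - f (x + s *\<^sub>R u) - f (x + s *\<^sub>R v) + f x - s\<^sup>2 * Dv u\<bar>
      \<le> e * s\<^sup>2 * (norm u + 2 * norm v)"
    using second_difference_estimate[OF W df Dv e, of u] by auto
  obtain d2 where d2: "d2 > 0" "\<And>s. 0 < s \<and> s < d2 \<Longrightarrow>
    \<bar>f (x + s *\<^sub>R v + s *\<^sub>R u) - f (x + s *\<^sub>R v) - f (x + s *\<^sub>R u) + f x - s\<^sup>2 * Du v\<bar>
      \<le> e * s\<^sup>2 * (norm v + 2 * norm u)"
    using second_difference_estimate[OF W df Du e, of v] by auto
  obtain s where s: "0 < s" "s < d1" "s < d2"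
    using d1(1) d2(1) field_lbound_gt_zero by blast
  have sw: "x + s *\<^sub>R v + s *\<^sub>R u = x + s *\<^sub>R u + s *\<^sub>R v" by (simp add: add_ac)
  have "\<bar>s\<^sup>2 * Dv u - s\<^sup>2 * Du v\<bar> \<le> e * s\<^sup>2 * (norm u + 2 * norm v) + e * s\<^sup>2 * (norm v + 2 * norm u)"
    using d1(2)[of s] d2(2)[of s] s unfolding sw by linarith
  moreover have "\<bar>s\<^sup>2 * Dv u - s\<^sup>2 * Du v\<bar> = s\<^sup>2 * c"
    by (simp add: c_def abs_mult flip: right_diff_distrib)
  moreover have "e * s\<^sup>2 * (norm u + 2 * norm v) + e * s\<^sup>2 * (norm v + 2 * norm u) = s\<^sup>2 * (e * (K - 1))"
    by (simp add: K_def algebra_simps)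
  ultimately have "c \<le> e * (K - 1)" using s by simp
  also have "\<dots> < e * K" using e by simp
  also have "\<dots> = c" using K by (simp add: e_def)
  finally show False by simp
qed

lemma symmetric_second_derivative:
  fixes f :: "'a::real_normed_vector \<Rightarrow> 'b::euclidean_space"
  assumes W: "open W" "x \<in> W" and df: "\<And>y. y \<in> W \<Longrightarrow> f differentiable (at y)"
    and Dv: "((\<lambda>y. frechet_derivative f (at y) v) has_derivative Dv) (at x)"
    and Du: "((\<lambda>y. frechet_derivative f (at y) u) has_derivative Du) (at x)"
  shows "Dv u = Du v"
proof (rule euclidean_eqI)
  fix b :: 'b assume "b \<in> Basis"
  have hd: "((\<lambda>y. f y \<bullet> b) has_derivative (\<lambda>v. frechet_derivative f (at y) v \<bullet> b)) (at y)" if "y \<in> W" for y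
    using df[OF that] frechet_derivative_works by (auto intro!: derivative_eq_intros)
  have fd: "frechet_derivative (\<lambda>y. f y \<bullet> b) (at y) = (\<lambda>v. frechet_derivative f (at y) v \<bullet> b)" if "y \<in> W" for y
    using frechet_derivative_at[OF hd[OF that]] by simp
  have "((\<lambda>y. frechet_derivative (\<lambda>y. f y \<bullet> b) (at y) w) has_derivative (\<lambda>z. D z \<bullet> b)) (at x)"
    if "((\<lambda>y. frechet_derivative f (at y) w) has_derivative D) (at x)" for w D
  proof (rule has_derivative_transform_within_open[OF _ W])
    show "((\<lambda>y. frechet_derivative f (at y) w \<bullet> b) has_derivative (\<lambda>z. D z \<bullet> b)) (at x)"
      using that by (auto intro!: derivative_eq_intros)
  qed (simp add: fd)
  from this[OF Dv] this[OF Du] show "Dv u \<bullet> b = Du v \<bullet> b"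
    by (intro symmetric_second_derivative_real[OF W, of "\<lambda>y. f y \<bullet> b"])
       (use hd in \<open>auto simp: differentiable_def\<close>)
qed

lemma smooth_onD:
  assumes "smooth_on S f" "x \<in> S"
  shows smooth_on_differentiable: "f differentiable (at x)"
    and smooth_on_has_derivative: "(f has_derivative frechet_derivative f (at x)) (at x)"
    and smooth_on_differentiable_deriv: "(\<lambda>y. frechet_derivative f (at y) v) differentiable (at x)"
proof -
  have *: "iter_dderiv f vs differentiable (at x)" for vs
    using assms unfolding smooth_on_def by blast
  show "f differentiable (at x)" using *[of "[]"] by simp
  then show "(f has_derivative frechet_derivative f (at x)) (at x)" using frechet_derivative_works by blast
  show "(\<lambda>y. frechet_derivative f (at y) v) differentiable (at x)" using *[of "[v]"] by simp
qed

section \<open>Derivatives along vector fields\<close>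

text \<open>A product rule. Differentiability is available only for the directional derivatives with
  a fixed direction, so the moving direction \<open>Y y\<close> is expanded in the standard basis
  first.\<close>

lemma has_derivative_along_field:
  fixes G :: "'a::euclidean_space \<Rightarrow> 'b::real_normed_vector"
  assumes G: "smooth_on W G" and x: "x \<in> W" and Y: "(Y has_derivative Y') (at x)"
  shows "((\<lambda>y. frechet_derivative G (at y) (Y y)) has_derivative
    (\<lambda>h. frechet_derivative (\<lambda>y. frechet_derivative G (at y) (Y x)) (at x) h
        + frechet_derivative G (at x) (Y' h))) (at x)"
proof -
  define D where "D = (\<lambda>y. frechet_derivative G (at y))"
  define E where "E = (\<lambda>b. frechet_derivative (\<lambda>y. D y b) (at x))"
  have W: "open W" using G by (simp add: smooth_on_def)
  have lin: "linear (D y)" if "y \<in> W" for y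
    unfolding D_def using smooth_on_has_derivative[OF G that] by (rule has_derivative_linear)
  have expand: "D y v = (\<Sum>b\<in>Basis. (v \<bullet> b) *\<^sub>R D y b)" if "y \<in> W" for y v
    by (subst euclidean_representation[of v, symmetric])
       (simp add: linear_sum[OF lin[OF that]] linear_cmul[OF lin[OF that]])
  have E: "((\<lambda>y. D y b) has_derivative E b) (at x)" for b
    unfolding E_def D_def using smooth_on_differentiable_deriv[OF G x] frechet_derivative_works by blast
  have main: "((\<lambda>y. D y (Z y)) has_derivative
      (\<lambda>h. \<Sum>b\<in>Basis. (Z x \<bullet> b) *\<^sub>R E b h + (Z' h \<bullet> b) *\<^sub>R D x b)) (at x)"
    if Z: "(Z has_derivative Z') (at x)" for Z Z'
  proof (rule has_derivative_transform_within_open[OF _ W x])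
    show "((\<lambda>y. \<Sum>b\<in>Basis. (Z y \<bullet> b) *\<^sub>R D y b) has_derivative
      (\<lambda>h. \<Sum>b\<in>Basis. (Z x \<bullet> b) *\<^sub>R E b h + (Z' h \<bullet> b) *\<^sub>R D x b)) (at x)"
      by (intro has_derivative_sum has_derivative_scaleR has_derivative_inner_left E Z)
  qed (simp add: expand)
  have "((\<lambda>y. D y (Y x)) has_derivative (\<lambda>h. \<Sum>b\<in>Basis. (Y x \<bullet> b) *\<^sub>R E b h)) (at x)"
    using main[of "\<lambda>_. Y x" "\<lambda>_. 0"] by simp
  then have "E (Y x) = (\<lambda>h. \<Sum>b\<in>Basis. (Y x \<bullet> b) *\<^sub>R E b h)"
    unfolding E_def using frechet_derivative_at by fastforce
  then have "(\<lambda>h. E (Y x) h + D x (Y' h)) =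
     (\<lambda>h. \<Sum>b\<in>Basis. (Y x \<bullet> b) *\<^sub>R E b h + (Y' h \<bullet> b) *\<^sub>R D x b)"
    by (subst expand[OF x]) (simp add: sum.distrib)
  with main[OF Y] show ?thesis unfolding D_def E_def by simp
qed

text \<open>The second-order terms cancel by symmetry; what remains is \<open>DG\<close> applied to
  the Lie bracket of the two fields at \<open>x\<close>. The fields need only be differentiable at
  that point.\<close>

lemma derivative_along_fields_commutator:
  fixes G :: "'a::euclidean_space \<Rightarrow> 'b::euclidean_space"
  assumes G: "smooth_on W G" and x: "x \<in> W"
    and Y: "(Y has_derivative Y') (at x)" and Z: "(Z has_derivative Z') (at x)"
  obtains A B where
    "((\<lambda>y. frechet_derivative G (at y) (Y y)) has_derivative A) (at x)"
    "((\<lambda>y. frechet_derivative G (at y) (Z y)) has_derivative B) (at x)"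
    "A (Z x) - B (Y x) = frechet_derivative G (at x) (Y' (Z x) - Z' (Y x))"
proof -
  have W: "open W" using G by (simp add: smooth_on_def)
  have D: "((\<lambda>y. frechet_derivative G (at y) v) has_derivative
      frechet_derivative (\<lambda>y. frechet_derivative G (at y) v) (at x)) (at x)" for v
    using smooth_on_differentiable_deriv[OF G x] frechet_derivative_works by blast
  note lin = has_derivative_linear[OF smooth_on_has_derivative[OF G x]]
  show ?thesis
    by (rule that[OF has_derivative_along_field[OF G x Y] has_derivative_along_field[OF G x Z]])
       (simp add: linear_diff[OF lin] symmetric_second_derivative[OF W x smooth_on_differentiable[OF G] D D])
qed

text \<open>The map \<open>\<Phi> y = y - m + L (F y - DF(m)(y - m))\<close> with \<open>L\<close> a right inverse of \<open>DF(m)\<close> satisfies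
  \<open>DF(m) (\<Phi> y) = F y\<close> and has derivative the identity at \<open>m\<close>; its local inverse straightens the zero set of
  \<open>F\<close> to the kernel of \<open>DF(m)\<close>.\<close>

lemma zero_set_chart:
  fixes F :: "'a::euclidean_space \<Rightarrow> 'b::euclidean_space"
  assumes F: "smooth_on W F" and m: "m \<in> W" "F m = 0"
    and surj: "surj (frechet_derivative F (at m))"
  obtains d U g where "d > 0" "open U" "m \<in> U" "g 0 = m"
    "\<And>k. k \<in> ball 0 d \<Longrightarrow> g differentiable (at k)"
    "(g has_derivative (\<lambda>h. h)) (at 0)"
    "\<And>k. k \<in> ball 0 d \<Longrightarrow> frechet_derivative F (at m) k = 0 \<Longrightarrow> g k \<in> W \<and> F (g k) = 0"
    "\<And>y. y \<in> U \<Longrightarrow> F y = 0 \<Longrightarrow> \<exists>k\<in>ball 0 d. frechet_derivative F (at m) k = 0 \<and> g k = y"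
proof -
  have W: "open W" using F by (simp add: smooth_on_def)
  define D where "D = (\<lambda>y. frechet_derivative F (at y))"
  have hD: "(F has_derivative D y) (at y)" if "y \<in> W" for y
    unfolding D_def by (rule smooth_on_has_derivative[OF F that])
  have linD: "linear (D m)" using hD[OF m(1)] by (rule has_derivative_linear)
  obtain L where L: "linear L" "D m \<circ> L = id"
    using linear_surjective_right_inverse[OF linD] surj by (auto simp: D_def)
  have DL: "D m (L z) = z" for z using L(2) by (simp add: o_def fun_eq_iff)
  have bL: "bounded_linear L" using L(1) by (simp add: linear_conv_bounded_linear)
  have bDm: "bounded_linear (D m)" using linD by (simp add: linear_conv_bounded_linear)
  define \<Phi> where "\<Phi> = (\<lambda>y. y - m + L (F y - D m (y - m)))"
  define \<Phi>' where "\<Phi>' = (\<lambda>y. Blinfun (\<lambda>h. h + L (D y h - D m h)))"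
  have \<Phi>_der: "(\<Phi> has_derivative (\<lambda>h. h + L (D y h - D m h))) (at y)" if "y \<in> W" for y
  proof -
    have "((\<lambda>y. F y - D m (y - m)) has_derivative (\<lambda>h. D y h - D m (h - 0))) (at y)"
      by (intro has_derivative_diff hD that bounded_linear.has_derivative[OF bDm] has_derivative_ident has_derivative_const)
    from bounded_linear.has_derivative[OF bL this]
    have "(\<Phi> has_derivative (\<lambda>h. h - 0 + L (D y h - D m (h - 0)))) (at y)"
      unfolding \<Phi>_def by (intro has_derivative_add has_derivative_diff has_derivative_ident has_derivative_const)
    then show ?thesis by simp
  qed
  have ap: "blinfun_apply (\<Phi>' y) = (\<lambda>h. h + L (D y h - D m h))" if "y \<in> W" for y
    unfolding \<Phi>'_def using has_derivative_bounded_linear[OF \<Phi>_der[OF that]] by (rule bounded_linear_Blinfun_apply)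
  have der: "(\<Phi> has_derivative blinfun_apply (\<Phi>' y)) (at y)" if "y \<in> W" for y
    using \<Phi>_der[OF that] ap[OF that] by simp
  \<comment> \<open>The inverse function theorem needs continuity in the operator norm; in finite
    dimension this follows from continuity on each basis vector.\<close>
  have cont: "continuous_on W \<Phi>'"
  proof (rule continuous_on_blinfun_componentwise)
    fix i :: 'a assume "i \<in> Basis"
    have "continuous_on W (\<lambda>y. D y i)"
      unfolding D_def by (intro continuous_at_imp_continuous_on ballI differentiable_imp_continuous_within
          smooth_on_differentiable_deriv[OF F])
    then have "continuous_on W (\<lambda>y. i + L (D y i - D m i))"
      by (intro continuous_intros bounded_linear.continuous_on[OF bL])
    then show "continuous_on W (\<lambda>y. blinfun_apply (\<Phi>' y) i)"
      by (rule continuous_on_eq) (simp add: ap)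
  qed
  have id: "id_blinfun o\<^sub>L \<Phi>' m = id_blinfun"
    by (rule blinfun_eqI) (simp add: ap m linear_0[OF L(1)])
  have \<Phi>m: "\<Phi> m = 0" by (simp add: \<Phi>_def m linear_0[OF L(1)] linear_0[OF linD])
  obtain U' V g g' where g: "open U'" "U' \<subseteq> W" "m \<in> U'" "open V" "\<Phi> m \<in> V" "homeomorphism U' V \<Phi> g"
    "\<And>y. y \<in> V \<Longrightarrow> (g has_derivative (g' y)) (at y)"
    "\<And>y. y \<in> V \<Longrightarrow> g' y = inv (blinfun_apply (\<Phi>'(g y)))"
    using inverse_function_theorem[OF W der cont m(1) id] by metis
  have gV: "g k \<in> U'" "\<Phi> (g k) = k" if "k \<in> V" for k
    using homeomorphism_image2[OF g(6)] homeomorphism_apply2[OF g(6) that] that by auto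
  have DF: "D m (\<Phi> y) = F y" for y
    by (simp add: \<Phi>_def linear_add[OF linD] DL)
  have g0: "g 0 = m" using homeomorphism_apply1[OF g(6,3)] \<Phi>m by simp
  obtain d where d: "d > 0" "ball 0 d \<subseteq> V"
    using g(4,5) \<Phi>m open_contains_ball by metis
  show ?thesis
  proof (rule that[OF d(1)])
    show "open (\<Phi> -` ball 0 d \<inter> U')"
      using continuous_open_preimage[OF homeomorphism_cont1[OF g(6)] g(1) open_ball] by (simp add: Int_commute)
    show "m \<in> \<Phi> -` ball 0 d \<inter> U'" using g(3) \<Phi>m d by simp
    show "g 0 = m" by fact
    show "g differentiable (at k)" if "k \<in> ball 0 d" for k
      using g(7) d that unfolding differentiable_def by blast
    have "g' 0 = inv (\<lambda>h. h)"
      using g(5) g(8)[of 0] by (simp add: g0 \<Phi>m ap m linear_0[OF L(1)])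
    also have "\<dots> = (\<lambda>h. h)" using inv_id by (simp add: id_def)
    finally show "(g has_derivative (\<lambda>h. h)) (at 0)" using g(5) g(7)[of 0] \<Phi>m by simp
    show "g k \<in> W \<and> F (g k) = 0" if "k \<in> ball 0 d" "frechet_derivative F (at m) k = 0" for k
    proof -
      have "k \<in> V" using that d by blast
      from gV[OF this] show ?thesis using that g(2) DF[of "g k"] by (auto simp: D_def)
    qed
    show "\<exists>k\<in>ball 0 d. frechet_derivative F (at m) k = 0 \<and> g k = y"
      if "y \<in> \<Phi> -` ball 0 d \<inter> U'" "F y = 0" for y
      using that DF[of y] homeomorphism_apply1[OF g(6), of y] by (intro bexI[of _ "\<Phi> y"]) (auto simp: D_def)
  qed
qed

section \<open>Curves on a zero set\<close>

text \<open>The chart \<open>g\<close> carries the line t k of the kernel into \<open>M\<close>, and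
  its derivative at 0 is the identity, so the image curve has velocity \<open>k\<close>.\<close>

lemma kernel_subset_tangent_space:
  assumes F: "smooth_on W F" and m: "m \<in> M \<inter> W" and M: "M \<inter> W = {y\<in>W. F y = 0}"
    and surj: "surj (frechet_derivative (F :: pt \<Rightarrow> 'b::euclidean_space) (at m))"
    and k: "frechet_derivative F (at m) k = 0"
  shows "k \<in> tangent_space M m"
proof -
  have m': "m \<in> W" "F m = 0" using m M by auto
  obtain d U g where g: "d > 0" "g 0 = m" "(g has_derivative (\<lambda>h. h)) (at 0)"
    "\<And>k. k \<in> ball 0 d \<Longrightarrow> frechet_derivative F (at m) k = 0 \<Longrightarrow> g k \<in> W \<and> F (g k) = 0"
    by (rule zero_set_chart[OF F m' surj]) blast
  note lin = has_derivative_linear[OF smooth_on_has_derivative[OF F m'(1)]]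
  \<comment> \<open>The summand 1 covers the case \<open>k = 0\<close>.\<close>
  define e where "e = d / (norm k + 1)"
  have e: "e > 0" using g(1) by (simp add: e_def add_nonneg_pos)
  have "g (t *\<^sub>R k) \<in> M" if "\<bar>t\<bar> < e" for t
  proof -
    have "\<bar>t\<bar> * norm k \<le> \<bar>t\<bar> * (norm k + 1)" by (simp add: mult_left_mono)
    also have "\<dots> < e * (norm k + 1)" using that by (intro mult_strict_right_mono) (auto simp: add_nonneg_pos)
    also have "\<dots> = d" by (simp add: e_def add_nonneg_eq_0_iff)
    finally have "t *\<^sub>R k \<in> ball 0 d" by simp
    then show ?thesis using g(4)[of "t *\<^sub>R k"] M k by (auto simp: linear_cmul[OF lin])
  qed
  then have "(\<lambda>t. g (t *\<^sub>R k)) ` {-e<..<e} \<subseteq> M" by (auto simp: abs_less_iff)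
  moreover have "((\<lambda>t. g (t *\<^sub>R k)) has_vector_derivative k) (at 0)"
  proof -
    have "((\<lambda>t. t *\<^sub>R k) has_derivative (\<lambda>t. t *\<^sub>R k)) (at 0)" by (auto intro!: derivative_eq_intros)
    from has_derivative_compose[OF this, of g "\<lambda>h. h"] g(3) show ?thesis
      by (simp add: has_vector_derivative_def)
  qed
  ultimately show ?thesis unfolding tangent_space_def using e g(2) by (intro CollectI exI[of _ e] conjI exI[of _ "\<lambda>t. g (t *\<^sub>R k)"]) auto
qed

lemma velocity_in_tangent_space:
  assumes "open I" "t \<in> I" "\<gamma> ` I \<subseteq> M" "(\<gamma> has_vector_derivative v) (at t)"
  shows "v \<in> tangent_space M (\<gamma> t)"
proof -
  obtain e where e: "e > 0" "ball t e \<subseteq> I" using assms open_contains_ball by blast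
  have "((\<lambda>s. t + s) has_derivative (\<lambda>s. s)) (at 0)"
    by (auto intro!: derivative_eq_intros)
  from has_derivative_compose[OF this, of \<gamma>] assms(4)
  have "((\<lambda>s. \<gamma> (t + s)) has_vector_derivative v) (at 0)"
    by (simp add: has_vector_derivative_def)
  moreover have "(\<lambda>s. \<gamma> (t + s)) ` {-e<..<e} \<subseteq> M"
    using e assms(3) by (force simp: dist_real_def)
  ultimately show ?thesis unfolding tangent_space_def using e
    by (intro CollectI exI[of _ e] conjI exI[of _ "\<lambda>s. \<gamma> (t + s)"]) auto
qed

text \<open>A point of \<open>M\<close> near \<open>m\<close> is joined to \<open>m\<close> by the
  image under the chart of a segment in the kernel, along which \<Psi> has derivative zero. The
  hypothesis speaks of curves in \<open>M\<close> and not of a derivative of \<Psi>, because it is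
  applied to a \<Psi> built from values chosen point by point on \<open>M\<close>.\<close>

lemma submanifold_locally_path_constant:
  fixes \<Psi> :: "pt \<Rightarrow> 'c::real_normed_vector"
  assumes M: "submanifold5 M" "m \<in> M"
    and \<Psi>: "\<And>I \<gamma> t v. open I \<Longrightarrow> t \<in> I \<Longrightarrow> \<gamma> ` I \<subseteq> M \<Longrightarrow> (\<gamma> has_vector_derivative v) (at t)
        \<Longrightarrow> v \<in> tangent_space M (\<gamma> t) \<Longrightarrow> ((\<lambda>s. \<Psi> (\<gamma> s)) has_vector_derivative 0) (at t)"
  shows "\<exists>U. open U \<and> m \<in> U \<and> (\<forall>y\<in>M \<inter> U. \<Psi> y = \<Psi> m)"
proof -
  obtain W and F :: "pt \<Rightarrow> real^3" where F: "m \<in> W" "smooth_on W F" "M \<inter> W = {y\<in>W. F y = 0}"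
    "surj (frechet_derivative F (at m))"
    using M unfolding submanifold5_def by (meson IntI)
  have m': "F m = 0" using F M by auto
  have W: "open W" using F by (simp add: smooth_on_def)
  obtain d U g where g: "d > 0" "open U" "m \<in> U" "g 0 = m"
    "\<And>k. k \<in> ball 0 d \<Longrightarrow> g differentiable (at k)"
    "\<And>k. k \<in> ball 0 d \<Longrightarrow> frechet_derivative F (at m) k = 0 \<Longrightarrow> g k \<in> W \<and> F (g k) = 0"
    "\<And>y. y \<in> U \<Longrightarrow> F y = 0 \<Longrightarrow> \<exists>k\<in>ball 0 d. frechet_derivative F (at m) k = 0 \<and> g k = y"
    by (rule zero_set_chart[OF F(2,1) m' F(4)]) blast
  note lin = has_derivative_linear[OF smooth_on_has_derivative[OF F(2,1)]]
  have "\<Psi> y = \<Psi> m" if y: "y \<in> M \<inter> (U \<inter> W)" for y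
  proof -
    have "F y = 0" using y F(3) by auto
    then obtain k where k: "k \<in> ball 0 d" "frechet_derivative F (at m) k = 0" "g k = y"
      using g(7) y by blast
    define I where "I = (\<lambda>t. t *\<^sub>R k) -` ball 0 d"
    have I: "open I" unfolding I_def by (intro open_vimage continuous_intros) auto
    let ?\<gamma> = "\<lambda>t. g (t *\<^sub>R k)"
    have "g (t *\<^sub>R k) \<in> M" if "t \<in> I" for t
      using g(6)[of "t *\<^sub>R k"] k(2) F(3) that by (auto simp: I_def linear_cmul[OF lin])
    then have im: "?\<gamma> ` I \<subseteq> M" by blast
    have der: "((\<lambda>s. \<Psi> (?\<gamma> s)) has_vector_derivative 0) (at t)" if t: "t \<in> I" for t
    proof -
      have "g differentiable (at (t *\<^sub>R k))" using g(5) t by (auto simp: I_def)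
      then have "?\<gamma> differentiable (at t)"
        by (rule differentiable_compose) (intro differentiable_scaleR differentiable_ident differentiable_const)
      then obtain v where v: "(?\<gamma> has_vector_derivative v) (at t)"
        using vector_derivative_works by blast
      show ?thesis
        by (rule \<Psi>[OF I t im v]) (rule velocity_in_tangent_space[OF I t im v])
    qed
    have sub: "{0..1} \<subseteq> I"
    proof
      fix t :: real assume "t \<in> {0..1}"
      then have "norm (t *\<^sub>R k) \<le> norm k" by (simp add: mult_left_le_one_le)
      then show "t \<in> I" using k by (simp add: I_def)
    qed
    have "((\<lambda>s. \<Psi> (?\<gamma> s)) has_derivative (\<lambda>_. 0)) (at t within {0..1})" if "t \<in> {0..1}" for t
    proof (rule has_derivative_at_withinI)
      have "t \<in> I" using that sub by (rule subsetD[rotated])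
      from der[OF this] show "((\<lambda>s. \<Psi> (?\<gamma> s)) has_derivative (\<lambda>_. 0)) (at t)"
        by (simp add: has_vector_derivative_def)
    qed
    then have "\<exists>c. \<forall>t\<in>{0..1}. \<Psi> (?\<gamma> t) = c"
      by (intro has_derivative_zero_constant convex_real_interval)
    then have "\<Psi> (?\<gamma> 1) = \<Psi> (?\<gamma> 0)" by (metis atLeastAtMost_iff order_refl zero_le_one)
    then show ?thesis using k g(4) by simp
  qed
  then show ?thesis using g(2,3) W F(1) by (intro exI[of _ "U \<inter> W"]) auto
qed

section \<open>Quaternions and the nearly Kaehler metric\<close>

lemmas quat_coords = qmult_def qcnj_def qreal_def qRe_def prod_eq_iff complex_eq_iff
  inner_prod_def inner_complex_def

lemma qmult_assoc: "a \<odot> b \<odot> c = a \<odot> (b \<odot> c)"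
  by (simp add: quat_coords algebra_simps)

lemma bounded_bilinear_qmult: "bounded_bilinear (\<odot>)"
proof -
  have "bilinear (\<odot>)"
    by (auto simp: bilinear_def linear_iff quat_coords algebra_simps)
  then show ?thesis by (simp add: bilinear_conv_bounded_bilinear)
qed

interpretation qmult: bounded_bilinear "(\<odot>)" by (rule bounded_bilinear_qmult)

lemma bounded_linear_qcnj: "bounded_linear qcnj"
  by (simp add: linear_conv_bounded_linear[symmetric] linear_iff quat_coords algebra_simps)

lemma qcnj_add: "qcnj (a + b) = qcnj a + qcnj b"
  and qcnj_scaleR: "qcnj (c *\<^sub>R a) = c *\<^sub>R qcnj a"
  by (simp_all add: quat_coords)

lemma qcnj_qmult: "qcnj (a \<odot> b) = qcnj b \<odot> qcnj a"
  by (simp add: quat_coords algebra_simps)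

lemma qmult_one [simp]: "qreal 1 \<odot> a = a" "a \<odot> qreal 1 = a"
  by (simp_all add: quat_coords)

lemma qcnj_one [simp]: "qcnj (qreal 1) = qreal 1"
  by (simp add: quat_coords)

lemma inner_qmult_left: "inner (a \<odot> b) c = inner b (qcnj a \<odot> c)"
  by (simp add: quat_coords algebra_simps)

lemma inner_self_unit: "norm (p::'a::real_inner) = 1 \<Longrightarrow> inner p p = 1"
  by (simp add: norm_eq_1)

lemma qcnj_qmult_self: "qcnj p \<odot> p = inner p p *\<^sub>R qreal 1" "p \<odot> qcnj p = inner p p *\<^sub>R qreal 1"
  by (simp_all add: quat_coords algebra_simps)

lemma qcnj_qmult_unit [simp]:
  assumes "norm p = 1"
  shows "qcnj p \<odot> p = qreal 1" "p \<odot> qcnj p = qreal 1"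
    "qcnj p \<odot> (p \<odot> a) = a" "p \<odot> (qcnj p \<odot> a) = a"
  using assms by (simp_all add: qcnj_qmult_self inner_self_unit flip: qmult_assoc)

lemma norm_qcnj [simp]: "norm (qcnj a) = norm a"
  by (simp add: norm_eq_sqrt_inner quat_coords)

lemma norm_qmult: "norm (a \<odot> b) = norm a * norm b"
proof -
  have "inner (a \<odot> b) (a \<odot> b) = inner a a * inner b b"
    by (simp add: quat_coords algebra_simps)
  then show ?thesis by (simp add: norm_eq_sqrt_inner real_sqrt_mult)
qed

lemma inner_qmult_unit: "norm p = 1 \<Longrightarrow> inner (p \<odot> a) (p \<odot> b) = inner a b"
  by (simp add: inner_qmult_left)

lemma qinv_unit: "norm p = 1 \<Longrightarrow> qinv p = qcnj p"
  by (simp add: qinv_def)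

lemma qRe_eq_inner: "qRe a = inner (qreal 1) a"
  by (simp add: quat_coords)

lemma qRe_qcnj_qmult: "qRe (qcnj a \<odot> b) = inner a b"
  by (simp add: quat_coords)

text \<open>For imaginary quaternions this is the scalar triple product of three vectors of 3-space,
  hence alternating.\<close>

lemma imaginary_triple_product:
  assumes "qRe a = 0" "qRe b = 0" "qRe c = 0"
  shows imaginary_triple_product_cyclic: "inner (a \<odot> b) c = inner (b \<odot> c) a"
    and imaginary_triple_product_swap: "inner (a \<odot> b) c = - inner (b \<odot> a) c"
  using assms by (simp_all add: quat_coords algebra_simps)

lemma qcnj_imaginary: "qRe a = 0 \<Longrightarrow> qcnj a = - a"
  by (simp add: quat_coords)

lemma imaginary_unit_square: "qRe a = 0 \<Longrightarrow> norm a = 1 \<Longrightarrow> a \<odot> a = - qreal 1"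
  using qcnj_qmult_self(2)[of a] by (simp add: qcnj_imaginary qmult.minus_right inner_self_unit minus_equation_iff)

lemma S3S3_iff: "x \<in> S3S3 \<longleftrightarrow> norm (fst x) = 1 \<and> norm (snd x) = 1"
  by (cases x) (simp add: S3S3_def S3_def)

section \<open>The metric as a positive definite form\<close>

lemma NKg_unit:
  assumes "x \<in> S3S3"
  shows "NKg x Z Z' = 4/3 * (inner (fst Z) (fst Z') + inner (snd Z) (snd Z'))
     - 2/3 * (inner (qcnj (fst x) \<odot> fst Z) (qcnj (snd x) \<odot> snd Z')
            + inner (qcnj (fst x) \<odot> fst Z') (qcnj (snd x) \<odot> snd Z))"
  using assms by (simp add: NKg_def S3S3_iff qinv_unit Let_def)

lemma NKg_eq_inner:
  assumes "x \<in> S3S3"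
  shows "NKg x w Z = inner ((4/3) *\<^sub>R fst w - (2/3) *\<^sub>R (fst x \<odot> (qcnj (snd x) \<odot> snd w)),
     (4/3) *\<^sub>R snd w - (2/3) *\<^sub>R (snd x \<odot> (qcnj (fst x) \<odot> fst w))) Z"
proof -
  have "inner (fst x \<odot> (qcnj (snd x) \<odot> snd w)) (fst Z) = inner (qcnj (fst x) \<odot> fst Z) (qcnj (snd x) \<odot> snd w)"
    "inner (snd x \<odot> (qcnj (fst x) \<odot> fst w)) (snd Z) = inner (qcnj (fst x) \<odot> fst w) (qcnj (snd x) \<odot> snd Z)"
    by (metis inner_qmult_left inner_commute)+
  then show ?thesis unfolding NKg_unit[OF assms]
    by (subst inner_prod_def) (simp add: inner_diff_left algebra_simps)
qed

text \<open>Left translation of both components to the identity preserves norms; there the form is a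
  sum of squares, 2/3 (|a|^2 + |b|^2 + |a - b|^2).\<close>

lemma NKg_pos:
  assumes x: "x \<in> S3S3" and Z: "Z \<noteq> 0"
  shows "NKg x Z Z > 0"
proof -
  define a b where "a = qcnj (fst x) \<odot> fst Z" and "b = qcnj (snd x) \<odot> snd Z"
  have na: "inner (fst Z) (fst Z) = inner a a" "inner (snd Z) (snd Z) = inner b b"
    using x by (simp_all add: a_def b_def S3S3_iff inner_qmult_unit)
  have "NKg x Z Z = 4/3 * (inner a a + inner b b) - 4/3 * inner a b"
    unfolding NKg_unit[OF x] na by (simp add: a_def b_def)
  also have "\<dots> = 2/3 * (inner a a + inner b b) + 2/3 * inner (a - b) (a - b)"
    by (simp add: inner_diff inner_commute algebra_simps)
  also have "\<dots> = 2/3 * inner Z Z + 2/3 * inner (a - b) (a - b)"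
    by (simp only: inner_prod_def[of Z Z] na)
  also have "\<dots> > 0" using Z by (simp add: add_pos_nonneg)
  finally show ?thesis .
qed

lemma NKg_diff_left: "NKg x (v - w) Z = NKg x v Z - NKg x w Z"
  by (simp add: NKg_def Let_def qmult.diff_right inner_diff algebra_simps)

lemma NKg_add_left: "NKg x (v + w) Z = NKg x v Z + NKg x w Z"
  by (simp add: NKg_def Let_def qmult.add_right inner_add algebra_simps)

lemma NKg_scaleR_left: "NKg x (c *\<^sub>R v) Z = c * NKg x v Z"
  by (simp add: NKg_def Let_def qmult.scaleR_right algebra_simps)

text \<open>Riesz representation for \<open>NKg\<close>; it guarantees that the definite description
  in \<open>Gamma\<close> denotes. The metric is the Euclidean product composed with an operator
  \<open>B\<close>, injective by positivity and therefore surjective.\<close>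

lemma NKg_represents:
  assumes x: "x \<in> S3S3" and l: "linear (l :: pt \<Rightarrow> real)"
  shows "\<exists>!w. \<forall>Z. NKg x w Z = l Z"
proof -
  define B where "B = (\<lambda>w::pt. ((4/3) *\<^sub>R fst w - (2/3) *\<^sub>R (fst x \<odot> (qcnj (snd x) \<odot> snd w)),
     (4/3) *\<^sub>R snd w - (2/3) *\<^sub>R (snd x \<odot> (qcnj (fst x) \<odot> fst w))))"
  have g: "NKg x w Z = inner (B w) Z" for w Z unfolding B_def by (rule NKg_eq_inner[OF x])
  have lin: "linear B"
    by (auto simp: linear_iff B_def qmult.add_right qmult.scaleR_right scaleR_diff_right scaleR_add_right
        scaleR_scaleR mult.commute)
  have inj: "inj B"
  proof (subst linear_injective_0[OF lin], intro allI impI)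
    fix w assume "B w = 0"
    then have "NKg x w w = 0" by (simp add: g)
    then show "w = 0" using NKg_pos[OF x, of w] by (metis less_irrefl)
  qed
  have "surj B" using linear_injective_imp_surjective[OF lin inj] by simp
  \<comment> \<open>\<open>adjoint l 1\<close> is the Euclidean gradient of the functional
    \<open>l\<close>.\<close>
  then obtain w where "B w = adjoint l 1" by (metis surjD)
  then have "\<forall>Z. NKg x w Z = l Z" by (simp add: g adjoint_works[OF l, symmetric] adjoint_clauses[OF l])
  moreover have "w' = w''" if "\<forall>Z. NKg x w' Z = l Z" "\<forall>Z. NKg x w'' Z = l Z" for w' w''
  proof -
    have "inner (B w') Z = inner (B w'') Z" for Z using that by (metis g)
    then have "B w' = B w''" using vector_eq_rdot by blast
    then show ?thesis using inj by (simp add: inj_eq)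
  qed
  ultimately show ?thesis by blast
qed

section \<open>The connection in left-translated form\<close>

text \<open>Derivative of the mixed term of the metric, the only one that depends on the base point.
  The last summand comes from the factors 1/|p|^2 and 1/|q|^2 in \<open>qinv\<close>; it vanishes
  for \<open>X\<close> tangent to the two spheres.\<close>

definition pairing_deriv :: "pt \<Rightarrow> pt \<Rightarrow> quat \<Rightarrow> quat \<Rightarrow> real" where
  "pairing_deriv x X a b = inner (qcnj (fst X) \<odot> a) (qcnj (snd x) \<odot> b)
     + inner (qcnj (fst x) \<odot> a) (qcnj (snd X) \<odot> b)
     - 2 * (inner (fst x) (fst X) + inner (snd x) (snd X)) * inner (qcnj (fst x) \<odot> a) (qcnj (snd x) \<odot> b)"

lemma has_derivative_pairing:
  assumes x: "x \<in> S3S3"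
  shows "((\<lambda>y. inner (qinv (fst y) \<odot> a) (qinv (snd y) \<odot> b)) has_derivative (\<lambda>X. pairing_deriv x X a b)) (at x)"
proof -
  let ?n = "\<lambda>z::quat. inverse (inner z z)"
  have eq: "inner (qinv (fst y) \<odot> a) (qinv (snd y) \<odot> b) =
     ?n (fst y) * ?n (snd y) * inner (qcnj (fst y) \<odot> a) (qcnj (snd y) \<odot> b)" for y
    by (simp add: qinv_def qmult.scaleR_left power2_norm_eq_inner)
  have ne: "inner (fst x) (fst x) = 1" "inner (snd x) (snd x) = 1"
    using x by (auto simp: S3S3_iff norm_eq_1)
  have c1: "((\<lambda>y. qcnj (fst y) \<odot> a) has_derivative (\<lambda>X. qcnj (fst X) \<odot> a)) (at x)"
    by (intro bounded_linear_imp_has_derivative bounded_linear_compose[OF qmult.bounded_linear_left]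
        bounded_linear_compose[OF bounded_linear_qcnj] bounded_linear_fst)
  have c2: "((\<lambda>y. qcnj (snd y) \<odot> b) has_derivative (\<lambda>X. qcnj (snd X) \<odot> b)) (at x)"
    by (intro bounded_linear_imp_has_derivative bounded_linear_compose[OF qmult.bounded_linear_left]
        bounded_linear_compose[OF bounded_linear_qcnj] bounded_linear_snd)
  show ?thesis unfolding eq
    apply (rule has_derivative_eq_rhs)
     apply (rule derivative_intros c1 c2 | simp add: ne)+
    apply (rule ext)
    apply (simp add: pairing_deriv_def ne inner_commute algebra_simps)
    done
qed

lemma dg_eq:
  assumes x: "x \<in> S3S3"
  shows "dg x X Y Z = - 2/3 * (pairing_deriv x X (fst Y) (snd Z) + pairing_deriv x X (fst Z) (snd Y))"
proof -
  have "((\<lambda>y. NKg y Y Z) has_derivative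
    (\<lambda>X. - 2/3 * (pairing_deriv x X (fst Y) (snd Z) + pairing_deriv x X (fst Z) (snd Y)))) (at x)"
    unfolding NKg_def Let_def
    by (rule has_derivative_eq_rhs, (rule derivative_intros has_derivative_pairing[OF x])+)
       (simp add: fun_eq_iff)
  then show ?thesis unfolding dg_def by (simp add: frechet_derivative_at[symmetric])
qed

lemma NKg_Gamma:
  assumes x: "x \<in> S3S3"
  shows "NKg x (Gamma x X Y) Z = (dg x X Y Z + dg x Y X Z - dg x Z X Y) / 2"
proof -
  have "linear (\<lambda>Z. (dg x X Y Z + dg x Y X Z - dg x Z X Y) / 2)"
    unfolding dg_eq[OF x] pairing_deriv_def
    by (auto simp: linear_iff qmult.add_right qmult.add_left qmult.scaleR_right qmult.scaleR_left
        qcnj_add qcnj_scaleR inner_add algebra_simps add_divide_distrib diff_divide_distrib)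
  from theI'[OF NKg_represents[OF x this]] show ?thesis
    unfolding Gamma_def by blast
qed

lemma NKg_translated:
  assumes x: "x \<in> S3S3"
  shows "NKg x (fst x \<odot> a, snd x \<odot> b) (fst x \<odot> z, snd x \<odot> w)
    = 4/3 * (inner a z + inner b w) - 2/3 * (inner a w + inner z b)"
  using x by (simp add: NKg_unit S3S3_iff inner_qmult_unit)

text \<open>For tangent vectors written as (p u, q v) with u, v imaginary, conjugation is a change
  of sign and the normalising factors contribute nothing, so only triple products survive.\<close>

lemma dg_translated:
  assumes x: "x \<in> S3S3" and im: "qRe u = 0" "qRe v = 0" "qRe y = 0" "qRe y' = 0" "qRe z = 0" "qRe z' = 0"
  shows "dg x (fst x \<odot> u, snd x \<odot> v) (fst x \<odot> y, snd x \<odot> y') (fst x \<odot> z, snd x \<odot> z')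
    = 2/3 * (inner ((u - v) \<odot> y) z' + inner ((u - v) \<odot> z) y')"
proof -
  have n: "norm (fst x) = 1" "norm (snd x) = 1" using x by (auto simp: S3S3_iff)
  have p0: "inner p (p \<odot> a) = 0" if "norm p = 1" "qRe a = 0" for p a
    using inner_qmult_unit[OF that(1), of "qreal 1" a] that(2) by (simp add: qRe_eq_inner)
  have "pairing_deriv x (fst x \<odot> u, snd x \<odot> v) (fst x \<odot> a) (snd x \<odot> b) = - inner ((u - v) \<odot> a) b"
    if "qRe a = 0" "qRe b = 0" for a b
  proof -
    \<comment> \<open>Left multiplication by an imaginary quaternion is skew-adjoint.\<close>
    have "inner a (v \<odot> b) = - inner (v \<odot> a) b"
      using imaginary_triple_product_cyclic[of v b a] imaginary_triple_product_swap[of b a v]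
        imaginary_triple_product_cyclic[of v a b] imaginary_triple_product_cyclic[of a b v] that im
      by (simp add: inner_commute)
    then show ?thesis
      by (simp add: pairing_deriv_def p0 im n qcnj_qmult qmult_assoc qcnj_imaginary qmult.minus_left
          qmult.diff_left inner_diff_left)
  qed
  from this[of y z'] this[of z y'] show ?thesis by (simp add: dg_eq[OF x] im field_simps)
qed

text \<open>The Koszul formula for the normal (p \<nu>/2, q \<nu>) in the direction (p u, q v). Each
  triple product contains \<nu>, so all of them reduce to the skew form \<open>T\<close>
  below.\<close>

lemma covd_translated:
  assumes x: "x \<in> S3S3" and im: "qRe u = 0" "qRe v = 0" "qRe z = 0" "qRe w = 0" "qRe \<nu> = 0"
  shows "NKg x (fst x \<odot> e, snd x \<odot> f) (fst x \<odot> z, snd x \<odot> w)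
     + NKg x (Gamma x (fst x \<odot> u, snd x \<odot> v) (fst x \<odot> ((1/2) *\<^sub>R \<nu>), snd x \<odot> \<nu>)) (fst x \<odot> z, snd x \<odot> w)
    = 4/3 * (inner e z + inner f w) - 2/3 * (inner e w + inner z f)
      + 1/3 * inner ((2 *\<^sub>R u - v) \<odot> \<nu>) (w - z)"
proof -
  have i2: "qRe ((1/2) *\<^sub>R \<nu>) = 0" using im by (simp add: qRe_eq_inner)
  define T where "T = (\<lambda>a b. inner (a \<odot> \<nu>) b)"
  have T: "inner (a \<odot> \<nu>) b = T a b" for a b by (simp add: T_def)
  have 1: "inner (\<nu> \<odot> a) b = - T a b" "inner (a \<odot> b) \<nu> = - T a b" "T a b = - T b a"
    if "qRe a = 0" "qRe b = 0" for a b
    using imaginary_triple_product_cyclic[of a b \<nu>] imaginary_triple_product_cyclic[of b \<nu> a]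
      imaginary_triple_product_swap[of b \<nu> a] imaginary_triple_product_swap[of a \<nu> b]
      imaginary_triple_product_cyclic[of \<nu> a b] imaginary_triple_product_cyclic[of a \<nu> b]
      that im by (auto simp: T_def)
  show ?thesis
    unfolding NKg_translated[OF x] NKg_Gamma[OF x] dg_translated[OF x im(1,2) i2 im(5,3,4)]
      dg_translated[OF x i2 im(5) im(1,2,3,4)] dg_translated[OF x im(3,4,1,2) i2 im(5)]
    by (simp add: qmult.diff_left qmult.scaleR_left qmult.scaleR_right inner_diff_left inner_diff_right
        1(1,2) 1(3)[OF im(3,1)] 1(3)[OF im(3,2)] 1(3)[OF im(4,1)] 1(3)[OF im(4,2)] im T field_simps)
qed

text \<open>The pair in the first term is the derivative of the normal when the surface has
  eigenvalue \<mu> on \<open>v\<close>. Comparing coefficients of \<open>z\<close> forces the given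
  \<open>u\<close>; comparing those of \<open>w\<close> then leaves \<mu> + 1/(12 l) = l, which is
  the quadratic equation.\<close>

lemma shape_eigenvector_identity:
  fixes u v z w \<nu> :: quat and l \<mu> :: real
  assumes x: "x \<in> S3S3" and im: "qRe v = 0" "qRe z = 0" "qRe w = 0" "qRe \<nu> = 0"
    and \<nu>: "norm \<nu> = 1" "inner v \<nu> = 0" and l: "l \<noteq> 0" "l\<^sup>2 - \<mu> * l - 1/12 = 0"
    and u: "u = (1/2) *\<^sub>R v + (1 / (4 * l)) *\<^sub>R (v \<odot> \<nu>)"
  shows "NKg x (fst x \<odot> ((1/2) *\<^sub>R (u \<odot> \<nu> - v \<odot> \<nu> - \<mu> *\<^sub>R v)), snd x \<odot> (- \<mu> *\<^sub>R v)) (fst x \<odot> z, snd x \<odot> w)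
     + NKg x (Gamma x (fst x \<odot> u, snd x \<odot> v) (fst x \<odot> ((1/2) *\<^sub>R \<nu>), snd x \<odot> \<nu>)) (fst x \<odot> z, snd x \<odot> w)
    = - l * NKg x (fst x \<odot> u, snd x \<odot> v) (fst x \<odot> z, snd x \<odot> w)"
proof -
  have "qRe (v \<odot> \<nu>) = 0"
    using qRe_qcnj_qmult[of v \<nu>] im \<nu> by (simp add: qcnj_imaginary qmult.minus_left qRe_eq_inner)
  then have iu: "qRe u = 0" using im by (simp add: u qRe_eq_inner inner_add)
  have u\<nu>: "u \<odot> \<nu> = (1/2) *\<^sub>R (v \<odot> \<nu>) - (1 / (4 * l)) *\<^sub>R v"
    by (simp add: u qmult.add_left qmult.scaleR_left qmult_assoc imaginary_unit_square im \<nu> qmult.minus_right)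
  have \<mu>: "\<mu> = l - 1 / (12 * l)" using l by (simp add: field_simps power2_eq_square)
  have vz: "inner z v = inner v z" by (rule inner_commute)
  show ?thesis
    unfolding covd_translated[OF x iu im] unfolding NKg_translated[OF x] qmult.diff_left qmult.scaleR_left u\<nu> \<mu>
    using l(1) by (simp add: u inner_add inner_diff vz field_simps)
qed

section \<open>Hypersurfaces\<close>

text \<open>Both functions have the same composite with a curve in \<open>M\<close> through
  \<open>m\<close>. This is the tool for differentiating identities that hold only on
  \<open>M\<close>.\<close>

lemma tangent_space_derivative_unique:
  fixes f g :: "pt \<Rightarrow> 'b::real_normed_vector"
  assumes X: "X \<in> tangent_space M m"
    and f: "(f has_derivative f') (at m)" and g: "(g has_derivative g') (at m)"
    and U: "open U" "m \<in> U" and eq: "\<And>y. y \<in> M \<inter> U \<Longrightarrow> f y = g y"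
  shows "f' X = g' X"
proof -
  obtain e \<gamma> where \<gamma>: "e > 0" "\<gamma> 0 = m" "\<gamma> ` {-e<..<e} \<subseteq> M" "(\<gamma> has_vector_derivative X) (at 0)"
    using X unfolding tangent_space_def by blast
  have comp: "((\<lambda>t. k (\<gamma> t)) has_vector_derivative k' X) (at 0)"
    if "(k has_derivative k') (at m)" for k :: "pt \<Rightarrow> 'b" and k'
  proof -
    have "((\<lambda>t. k (\<gamma> t)) has_derivative (\<lambda>t. k' (t *\<^sub>R X))) (at 0)"
      using has_derivative_compose[of \<gamma> "\<lambda>t. t *\<^sub>R X" 0 UNIV k k'] \<gamma>(2,4) that
      by (simp add: has_vector_derivative_def)
    then show ?thesis
      by (simp add: has_vector_derivative_def linear_cmul[OF has_derivative_linear[OF that]])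
  qed
  have "isCont \<gamma> 0" using \<gamma>(4) by (rule has_vector_derivative_continuous)
  then have "(\<gamma> \<longlongrightarrow> m) (at 0)" using \<gamma>(2) by (simp add: isCont_def)
  then have "\<forall>\<^sub>F t in at 0. \<gamma> t \<in> U" using U by (rule topological_tendstoD)
  moreover have "\<forall>\<^sub>F t in at 0. t \<in> {-e<..<e}"
    using \<gamma>(1) by (intro eventually_at_in_open') auto
  ultimately have ev: "\<forall>\<^sub>F t in at 0. f (\<gamma> t) = g (\<gamma> t)"
    by eventually_elim (use \<gamma>(3) eq in blast)
  have f0: "f (\<gamma> 0) = g (\<gamma> 0)" using \<gamma>(1,2,3) U eq[of m] by force
  have "((\<lambda>t. g (\<gamma> t)) has_vector_derivative f' X) (at 0)"
    using comp[OF f] ev f0 unfolding has_vector_derivative_def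
    by (rule has_derivative_transform_eventually) simp
  from vector_derivative_unique_at[OF this comp[OF g]] show ?thesis .
qed

text \<open>Otherwise five nonzero pairwise orthogonal vectors would be independent in a space of
  dimension 4.\<close>

lemma quat_eq_zero_if_orthogonal:
  fixes v a b c d :: quat
  assumes ne: "a \<noteq> 0" "b \<noteq> 0" "c \<noteq> 0" "d \<noteq> 0"
    and orth: "inner a b = 0" "inner a c = 0" "inner a d = 0" "inner b c = 0" "inner b d = 0" "inner c d = 0"
      "inner v a = 0" "inner v b = 0" "inner v c = 0" "inner v d = 0"
  shows "v = 0"
proof (rule ccontr)
  assume v: "v \<noteq> 0"
  let ?B = "{v, a, b, c, d}"
  have "pairwise orthogonal ?B"
    using orth by (auto simp: pairwise_def orthogonal_def inner_commute)
  then have "independent ?B"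
    by (rule pairwise_orthogonal_independent) (use ne v in auto)
  then have "card ?B \<le> DIM(quat)" using independent_bound by blast
  moreover have "card ?B = 5"
  proof -
    have "v \<noteq> a" "v \<noteq> b" "v \<noteq> c" "v \<noteq> d" "a \<noteq> b" "a \<noteq> c" "a \<noteq> d" "b \<noteq> c" "b \<noteq> d" "c \<noteq> d"
      using orth ne v by auto
    then show ?thesis by simp
  qed
  ultimately show False by simp
qed

lemma exists_unit_orthogonal_quat:
  fixes a b c :: quat
  obtains w where "norm w = 1" "inner a w = 0" "inner b w = 0" "inner c w = 0"
proof -
  have "dim {a, b, c} \<le> card {a, b, c}" by (rule dim_le_card') simp
  also have "\<dots> \<le> 3" by (simp add: card_insert_if)
  finally have "dim {a, b, c} < DIM(quat)" by simp
  then obtain x where x: "x \<noteq> 0" "\<And>y. y \<in> span {a, b, c} \<Longrightarrow> orthogonal x y"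
    using orthogonal_to_subspace_exists by metis
  have "inner y (x /\<^sub>R norm x) = 0" if "y \<in> {a, b, c}" for y
    using x(2)[OF span_base[OF that]] by (simp add: orthogonal_def inner_commute)
  then show ?thesis using x(1) by (intro that[of "x /\<^sub>R norm x"]) auto
qed

text \<open>Explicit diagonalisation of a symmetric 2 by 2 matrix that is not a multiple of the
  identity.\<close>

lemma symmetric_plane_operator:
  fixes e1 e2 :: "'a::real_inner" and S :: "'a \<Rightarrow> 'a"
  assumes S: "linear S" and e: "inner e1 e1 = 1" "inner e2 e2 = 1" "inner e1 e2 = 0"
    and S1: "S e1 = a *\<^sub>R e1 + b *\<^sub>R e2" and S2: "S e2 = b *\<^sub>R e1 + c *\<^sub>R e2"
    and non: "b \<noteq> 0 \<or> a \<noteq> c"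
  obtains \<mu>1 \<mu>2 v1 v2 where "\<mu>1 \<noteq> \<mu>2" "v1 \<noteq> 0" "v2 \<noteq> 0" "S v1 = \<mu>1 *\<^sub>R v1" "S v2 = \<mu>2 *\<^sub>R v2"
    "v1 \<in> span {e1, e2}" "v2 \<in> span {e1, e2}"
proof (cases "b = 0")
  case True
  have "e1 \<noteq> 0" "e2 \<noteq> 0" using e by auto
  then show ?thesis using that[of a c e1 e2] S1 S2 non True by (simp add: span_base)
next
  case False
  \<comment> \<open>The square root of the discriminant of the characteristic polynomial; the
    eigenvector for \<mu> has coordinates (b, \<mu> - a), nonzero since \<open>b\<close> is.\<close>
  define d where "d = sqrt ((a - c)\<^sup>2 + 4 * b\<^sup>2)"
  have pos: "(a - c)\<^sup>2 + 4 * b\<^sup>2 > 0" using False by (simp add: add_nonneg_pos)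
  have d: "d > 0" "d\<^sup>2 = (a - c)\<^sup>2 + 4 * b\<^sup>2" using pos by (auto simp: d_def)
  have ev: "S (b *\<^sub>R e1 + (\<mu> - a) *\<^sub>R e2) = \<mu> *\<^sub>R (b *\<^sub>R e1 + (\<mu> - a) *\<^sub>R e2)"
    if "\<mu>\<^sup>2 - (a + c) * \<mu> + a * c - b\<^sup>2 = 0" for \<mu>
  proof -
    have "S (b *\<^sub>R e1 + (\<mu> - a) *\<^sub>R e2) = (b * a + (\<mu> - a) * b) *\<^sub>R e1 + (b * b + (\<mu> - a) * c) *\<^sub>R e2"
      by (simp add: linear_add[OF S] linear_cmul[OF S] S1 S2 scaleR_add_right scaleR_add_left)
    also have "b * a + (\<mu> - a) * b = \<mu> * b" by algebra
    also have "b * b + (\<mu> - a) * c = \<mu> * (\<mu> - a)" using that by algebra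
    finally show ?thesis by (simp add: scaleR_add_right)
  qed
  have ne: "b *\<^sub>R e1 + t *\<^sub>R e2 \<noteq> 0" for t
  proof
    assume "b *\<^sub>R e1 + t *\<^sub>R e2 = 0"
    then have "inner e1 (b *\<^sub>R e1 + t *\<^sub>R e2) = 0" by simp
    then show False using False e by (simp add: inner_add_right)
  qed
  have sp: "b *\<^sub>R e1 + t *\<^sub>R e2 \<in> span {e1, e2}" for t
    by (intro span_add span_scale span_base) auto
  show ?thesis
  proof (rule that[OF _ ne ne ev ev sp sp])
    show "(a + c + d) / 2 \<noteq> (a + c - d) / 2" using d by simp
    show "((a + c + d) / 2)\<^sup>2 - (a + c) * ((a + c + d) / 2) + a * c - b\<^sup>2 = 0"
      using d(2) by (simp add: field_simps power2_eq_square)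
    show "((a + c - d) / 2)\<^sup>2 - (a + c) * ((a + c - d) / 2) + a * c - b\<^sup>2 = 0"
      using d(2) by (simp add: field_simps power2_eq_square)
  qed
qed

section \<open>The normal field and the tangent space of the hypersurface\<close>

locale nk_hypersurface =
  fixes M :: "pt set" and \<xi> :: "pt \<Rightarrow> pt"
  assumes hyp: "hypersurface_with_normal M \<xi>"
    and Pxi: "m \<in> M \<Longrightarrow> NKP m (\<xi> m) = (1/2) *\<^sub>R \<xi> m + (sqrt 3 / 2) *\<^sub>R NKJ m (\<xi> m)"
begin

definition Nv :: "pt \<Rightarrow> quat" where "Nv y = snd (\<xi> y)"

text \<open>Taken from an ambient extension of \<xi>, so only its values on vectors tangent to
  \<open>M\<close> are determined by \<open>M\<close>; there it is minus the shape operator of the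
  surface factor.\<close>

definition dN :: "pt \<Rightarrow> pt \<Rightarrow> quat" where "dN y X = snd (frechet_derivative \<xi> (at y) X)"

text \<open>The expected tangent space, given by explicit linear equations;
  \<open>tangent_space_eq\<close> identifies it with \<open>tangent_space\<close>.\<close>

definition TM :: "pt \<Rightarrow> pt set" where
  "TM m = {X. inner (fst m) (fst X) = 0 \<and> inner (snd m) (snd X) = 0 \<and> inner (Nv m) (snd X) = 0}"

lemma M_S3S3: "m \<in> M \<Longrightarrow> m \<in> S3S3"
  using hyp by (auto simp: hypersurface_with_normal_def)

lemma unit_coords:
  assumes "m \<in> M"
  shows "norm (fst m) = 1" "norm (snd m) = 1" "inner (fst m) (fst m) = 1" "inner (snd m) (snd m) = 1"
  using M_S3S3[OF assms] by (auto simp: S3S3_iff norm_eq_1)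

lemma smooth_near:
  obtains W where "smooth_on W \<xi>" "open W" "M \<subseteq> W"
  using hyp by (auto simp: hypersurface_with_normal_def smooth_on_def)

lemma xi_has_derivative:
  assumes "m \<in> M"
  shows "(\<xi> has_derivative frechet_derivative \<xi> (at m)) (at m)"
  using smooth_near smooth_on_has_derivative assms by (metis subsetD)

lemma Nv_has_derivative: "m \<in> M \<Longrightarrow> (Nv has_derivative dN m) (at m)"
  unfolding Nv_def[abs_def] dN_def[abs_def] by (intro has_derivative_snd xi_has_derivative)

lemma linear_dN: "m \<in> M \<Longrightarrow> linear (dN m)"
  using Nv_has_derivative has_derivative_linear by blast

text \<open>With a the first component of \<xi> carried over by left multiplication with
  \<open>q p^-1\<close>, the second component of the hypothesis reads a = N/2 + (N - 2a)/2, hence 2a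
  = N.\<close>

lemma fst_xi:
  assumes m: "m \<in> M"
  shows "fst (\<xi> m) = (1/2) *\<^sub>R (fst m \<odot> (qcnj (snd m) \<odot> Nv m))"
proof -
  let ?a = "snd m \<odot> (qcnj (fst m) \<odot> fst (\<xi> m))"
  note u = unit_coords[OF m]
  have s3: "sqrt 3 / 2 * (1 / sqrt 3) = 1 / 2" by simp
  have "?a = (1/2) *\<^sub>R Nv m + (1/2) *\<^sub>R (Nv m - 2 *\<^sub>R ?a)"
    using arg_cong[OF Pxi[OF m], of snd] s3
    by (simp add: NKP_def NKJ_def Let_def qinv_unit u qmult_assoc Nv_def)
  also have "\<dots> = Nv m - ?a" by (simp add: prod_eq_iff complex_eq_iff field_simps)
  finally have "2 *\<^sub>R ?a = Nv m" by (simp add: scaleR_2 eq_diff_eq)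
  then have "qcnj (snd m) \<odot> Nv m = 2 *\<^sub>R (qcnj (fst m) \<odot> fst (\<xi> m))"
    by (metis qmult.scaleR_right qcnj_qmult_unit(3) u(2))
  then show ?thesis by (simp add: qmult.scaleR_right u)
qed

text \<open>Inserting \<open>fst_xi\<close>, the terms in the first component of \<open>X\<close>
  cancel (2/3 - 2/3) and those in the second add up to 4/3 - 1/3 = 1.\<close>

lemma NKg_xi:
  assumes m: "m \<in> M"
  shows "NKg m (\<xi> m) X = inner (Nv m) (snd X)"
proof -
  note u = unit_coords[OF m]
  have "inner (fst m \<odot> (qcnj (snd m) \<odot> Nv m)) (fst X) = inner (qcnj (fst m) \<odot> fst X) (qcnj (snd m) \<odot> Nv m)"
    by (metis inner_qmult_left inner_commute)
  then show ?thesis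
    unfolding NKg_unit[OF M_S3S3[OF m]] fst_xi[OF m]
    by (simp add: u qmult.scaleR_right inner_qmult_unit Nv_def[symmetric] field_simps)
qed

lemma normal_unit:
  assumes m: "m \<in> M"
  shows "inner (Nv m) (Nv m) = 1" "norm (Nv m) = 1" "inner (snd m) (Nv m) = 0" "inner (Nv m) (snd m) = 0"
proof -
  have h: "\<xi> m \<in> TS m" "NKg m (\<xi> m) (\<xi> m) = 1"
    using hyp m by (auto simp: hypersurface_with_normal_def)
  show 1: "inner (Nv m) (Nv m) = 1" using h(2) NKg_xi[OF m, of "\<xi> m"] by (simp add: Nv_def)
  then show "norm (Nv m) = 1" by (simp add: norm_eq_1)
  show "inner (snd m) (Nv m) = 0" using h(1) by (simp add: TS_def Nv_def)
  then show "inner (Nv m) (snd m) = 0" by (simp add: inner_commute)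
qed

lemma tangent_space_subset:
  assumes m: "m \<in> M"
  shows "tangent_space M m \<subseteq> TM m"
proof
  fix X assume X: "X \<in> tangent_space M m"
  have 1: "((\<lambda>y::pt. inner (fst y) (fst y)) has_derivative (\<lambda>X. 2 * inner (fst m) (fst X))) (at m)"
    by (auto intro!: derivative_eq_intros simp: inner_commute)
  have 2: "((\<lambda>y::pt. inner (snd y) (snd y)) has_derivative (\<lambda>X. 2 * inner (snd m) (snd X))) (at m)"
    by (auto intro!: derivative_eq_intros simp: inner_commute)
  have "2 * inner (fst m) (fst X) = 0"
    by (rule tangent_space_derivative_unique[OF X 1 has_derivative_const[of 1] open_UNIV]) (auto simp: unit_coords)
  moreover have "2 * inner (snd m) (snd X) = 0"
    by (rule tangent_space_derivative_unique[OF X 2 has_derivative_const[of 1] open_UNIV]) (auto simp: unit_coords)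
  moreover have "NKg m (\<xi> m) X = 0"
    using hyp m X by (auto simp: hypersurface_with_normal_def)
  ultimately show "X \<in> TM m" by (simp add: TM_def NKg_xi[OF m])
qed

text \<open>The kernel of \<open>DF\<close> lies in \<open>tangent_space\<close>, which lies in
  \<open>TM\<close>; both ends are kernels of surjections onto 3-space, so the chain
  collapses.\<close>

lemma tangent_kernel:
  assumes F: "smooth_on W F" and m: "m \<in> M \<inter> W" and M: "M \<inter> W = {y\<in>W. F y = 0}"
    and surj: "surj (frechet_derivative (F :: pt \<Rightarrow> real^3) (at m))"
  shows "{X. frechet_derivative F (at m) X = 0} = TM m" "tangent_space M m = TM m"
proof -
  let ?D = "frechet_derivative F (at m)"
  have mM: "m \<in> M" using m by blast
  have lin: "linear ?D" using smooth_on_has_derivative[OF F] m by (blast intro: has_derivative_linear)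
  have sub1: "{X. ?D X = 0} \<subseteq> tangent_space M m"
    using kernel_subset_tangent_space[OF F m M surj] by blast
  note sub2 = tangent_space_subset[OF mM]
  define Q :: "pt \<Rightarrow> real^3" where
    "Q = (\<lambda>X. vector [inner (fst m) (fst X), inner (snd m) (snd X), inner (Nv m) (snd X)])"
  have Q0: "Q X = 0 \<longleftrightarrow> X \<in> TM m" for X
    by (auto simp: Q_def TM_def vec_eq_iff forall_3)
  have linQ: "linear Q"
    by (auto simp: linear_iff Q_def vec_eq_iff forall_3 inner_add_right)
  have surjQ: "surj Q"
  proof (rule surjI)
    fix z :: "real^3"
    show "Q (z $ 1 *\<^sub>R fst m, z $ 2 *\<^sub>R snd m + z $ 3 *\<^sub>R Nv m) = z"
      using unit_coords[OF mM] normal_unit[OF mM]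
      by (simp add: Q_def vec_eq_iff forall_3 inner_add_right)
  qed
  \<comment> \<open>\<open>Q\<close> vanishes on the kernel of \<open>DF\<close>, so it factors as \<open>(Q \<circ> L) \<circ> DF\<close>; the factor is a surjective,
    hence injective, endomorphism of \<open>\<real>\<^sup>3\<close>.\<close>
  obtain L where L: "linear L" "?D \<circ> L = id"
    using linear_surjective_right_inverse[OF lin surj] by blast
  have factor: "Q X = Q (L (?D X))" for X
  proof -
    have "?D (X - L (?D X)) = 0"
      using L(2) by (simp add: linear_diff[OF lin] o_def fun_eq_iff)
    then have "Q (X - L (?D X)) = 0" using sub1 sub2 Q0 by blast
    then show ?thesis by (simp add: linear_diff[OF linQ])
  qed
  have lQL: "linear (Q \<circ> L)" using L(1) linQ by (rule linear_compose)
  have "surj (Q \<circ> L)"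
    using surjQ factor by (metis comp_apply surj_def)
  then have inj: "inj (Q \<circ> L)" using linear_surjective_imp_injective[OF lQL] by blast
  have "?D X = 0" if "X \<in> TM m" for X
  proof -
    have "(Q \<circ> L) (?D X) = (Q \<circ> L) 0"
      unfolding linear_0[OF lQL] using that Q0 factor by (metis comp_apply)
    then show ?thesis by (rule injD[OF inj])
  qed
  then show "{X. ?D X = 0} = TM m" "tangent_space M m = TM m" using sub1 sub2 by blast+
qed

lemma local_equations:
  assumes m: "m \<in> M"
  obtains W and F :: "pt \<Rightarrow> real^3" where "m \<in> W" "open W" "smooth_on W F" "M \<inter> W = {y\<in>W. F y = 0}"
    "\<And>y. y \<in> M \<inter> W \<Longrightarrow> {X. frechet_derivative F (at y) X = 0} = TM y"
    "tangent_space M m = TM m"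
proof -
  have "submanifold5 M" using hyp by (simp add: hypersurface_with_normal_def)
  with m obtain W and F :: "pt \<Rightarrow> real^3" where F: "m \<in> W" "smooth_on W F" "M \<inter> W = {y\<in>W. F y = 0}"
    "\<forall>y\<in>M \<inter> W. surj (frechet_derivative F (at y))"
    unfolding submanifold5_def by meson
  show ?thesis
  proof (rule that[OF F(1) _ F(2,3)])
    show "open W" using F(2) by (simp add: smooth_on_def)
    show "{X. frechet_derivative F (at y) X = 0} = TM y" if "y \<in> M \<inter> W" for y
      using tangent_kernel(1)[OF F(2) that F(3)] F(4) that by blast
    show "tangent_space M m = TM m"
      using tangent_kernel(2)[OF F(2) _ F(3)] F(1,4) m by blast
  qed
qed

lemma tangent_space_eq: "m \<in> M \<Longrightarrow> tangent_space M m = TM m"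
  by (erule local_equations)

text \<open>Extends a vector \<open>X\<close> tangent at one point to a field that is tangent along \<open>M\<close>;
  \<open>ext_field_deriv m X\<close> is its derivative at \<open>m\<close>, valid only for \<open>X\<close> tangent at \<open>m\<close>.\<close>

definition ext_field :: "pt \<Rightarrow> pt \<Rightarrow> pt" where
  "ext_field X y = (fst X - inner (fst X) (fst y) *\<^sub>R fst y,
     snd X - inner (snd X) (snd y) *\<^sub>R snd y - inner (snd X) (Nv y) *\<^sub>R Nv y)"

definition ext_field_deriv :: "pt \<Rightarrow> pt \<Rightarrow> pt \<Rightarrow> pt" where
  "ext_field_deriv m X h = (- inner (fst X) (fst h) *\<^sub>R fst m,
     - inner (snd X) (snd h) *\<^sub>R snd m - inner (snd X) (dN m h) *\<^sub>R Nv m)"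

lemma ext_field_in_TM: "y \<in> M \<Longrightarrow> ext_field X y \<in> TM y"
  using unit_coords[of y] normal_unit[of y]
  by (simp add: TM_def ext_field_def inner_diff_right inner_commute)

lemma ext_field_self: "X \<in> TM m \<Longrightarrow> ext_field X m = X"
  by (simp add: TM_def ext_field_def inner_commute)

lemma ext_field_has_derivative:
  assumes m: "m \<in> M" and X: "X \<in> TM m"
  shows "(ext_field X has_derivative ext_field_deriv m X) (at m)"
proof -
  have "inner (fst X) (fst m) = 0" "inner (snd X) (snd m) = 0" "inner (snd X) (Nv m) = 0"
    using X by (auto simp: TM_def inner_commute)
  then show ?thesis
    unfolding ext_field_def[abs_def] ext_field_deriv_def[abs_def]
    by (auto intro!: derivative_eq_intros Nv_has_derivative[OF m] simp: fun_eq_iff)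
qed

text \<open>Both extended fields are annihilated by \<open>DF\<close> along \<open>M\<close>, hence so is their bracket, whose
  component along \<open>N\<close> is the defect of symmetry.\<close>

lemma dN_symmetric:
  assumes m: "m \<in> M" and X: "X \<in> TM m" and Y: "Y \<in> TM m"
  shows "inner (dN m X) (snd Y) = inner (dN m Y) (snd X)"
proof -
  obtain W and F :: "pt \<Rightarrow> real^3" where F: "m \<in> W" "open W" "smooth_on W F"
    "\<And>y. y \<in> M \<inter> W \<Longrightarrow> {X. frechet_derivative F (at y) X = 0} = TM y"
    by (rule local_equations[OF m]) blast
  note Xd = ext_field_has_derivative[OF m X] and Yd = ext_field_has_derivative[OF m Y]
  obtain A B where
    A: "((\<lambda>y. frechet_derivative F (at y) (ext_field X y)) has_derivative A) (at m)" and
    B: "((\<lambda>y. frechet_derivative F (at y) (ext_field Y y)) has_derivative B) (at m)" and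
    AB: "A (ext_field Y m) - B (ext_field X m) = frechet_derivative F (at m) (ext_field_deriv m X (ext_field Y m) - ext_field_deriv m Y (ext_field X m))"
    by (rule derivative_along_fields_commutator[OF F(3,1) Xd Yd])
  have z: "frechet_derivative F (at y) (ext_field Z y) = 0" if "y \<in> M \<inter> W" for y Z
    using F(4)[OF that] ext_field_in_TM[of y] that by blast
  have T: "X \<in> tangent_space M m" "Y \<in> tangent_space M m" using X Y tangent_space_eq[OF m] by auto
  have "A Y = 0" by (rule tangent_space_derivative_unique[OF T(2) A has_derivative_const[of 0] F(2,1)]) (rule z)
  moreover have "B X = 0" by (rule tangent_space_derivative_unique[OF T(1) B has_derivative_const[of 0] F(2,1)]) (rule z)
  ultimately have "frechet_derivative F (at m) (ext_field_deriv m X Y - ext_field_deriv m Y X) = 0"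
    using AB X Y by (simp add: ext_field_self)
  then have "ext_field_deriv m X Y - ext_field_deriv m Y X \<in> TM m" using F(1) F(4)[of m] m by blast
  then have "inner (Nv m) (snd (ext_field_deriv m X Y - ext_field_deriv m Y X)) = 0" by (simp add: TM_def)
  then show ?thesis
    using normal_unit[OF m] by (simp add: ext_field_deriv_def inner_diff_right inner_commute)
qed

section \<open>The derivative of the normal field along the hypersurface\<close>

lemma dN_orthogonal:
  assumes m: "m \<in> M" and X: "X \<in> TM m"
  shows "inner (Nv m) (dN m X) = 0" "inner (snd m) (dN m X) = 0"
proof -
  have T: "X \<in> tangent_space M m" using X tangent_space_eq[OF m] by auto
  have 1: "((\<lambda>y. inner (Nv y) (Nv y)) has_derivative (\<lambda>X. 2 * inner (Nv m) (dN m X))) (at m)"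
    by (auto intro!: derivative_eq_intros Nv_has_derivative[OF m] simp: inner_commute)
  have "2 * inner (Nv m) (dN m X) = 0"
    by (rule tangent_space_derivative_unique[OF T 1 has_derivative_const[of 1] open_UNIV]) (auto simp: normal_unit)
  then show "inner (Nv m) (dN m X) = 0" by simp
  have 2: "((\<lambda>y. inner (snd y) (Nv y)) has_derivative (\<lambda>X. inner (snd m) (dN m X) + inner (snd X) (Nv m))) (at m)"
    by (auto intro!: derivative_eq_intros Nv_has_derivative[OF m])
  have "inner (snd m) (dN m X) + inner (snd X) (Nv m) = 0"
    by (rule tangent_space_derivative_unique[OF T 2 has_derivative_const[of 0] open_UNIV]) (auto simp: normal_unit)
  then show "inner (snd m) (dN m X) = 0" using X by (simp add: TM_def inner_commute)
qed

text \<open>The normal does not change along the first factor: for Z = (Z_1, 0), symmetry of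
  \<open>dN\<close> tested against (0, dN Z) gives |dN Z|^2 = 0.\<close>

lemma dN_eq_dN_snd:
  assumes m: "m \<in> M" and X: "X \<in> TM m"
  shows "dN m X = dN m (0, snd X)"
proof -
  let ?Z = "(fst X, 0) :: pt"
  have Z: "?Z \<in> TM m" using X by (simp add: TM_def)
  have "(0, dN m ?Z) \<in> TM m" using dN_orthogonal[OF m Z] by (simp add: TM_def)
  from dN_symmetric[OF m Z this] have "dN m ?Z = 0" by simp
  moreover have "X = ?Z + (0, snd X)" by (simp add: prod_eq_iff)
  ultimately show ?thesis by (metis linear_add[OF linear_dN[OF m]] add_0)
qed

lemma fst_derivative_xi:
  assumes m: "m \<in> M" and X: "X \<in> TM m"
  shows "fst (frechet_derivative \<xi> (at m) X) = (1/2) *\<^sub>R (fst X \<odot> (qcnj (snd m) \<odot> Nv m)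
     + fst m \<odot> (qcnj (snd X) \<odot> Nv m) + fst m \<odot> (qcnj (snd m) \<odot> dN m X))"
proof -
  have T: "X \<in> tangent_space M m" using X tangent_space_eq[OF m] by auto
  have q: "((\<lambda>y::pt. qcnj (snd y)) has_derivative (\<lambda>X. qcnj (snd X))) (at m)"
    by (intro bounded_linear_imp_has_derivative bounded_linear_compose[OF bounded_linear_qcnj] bounded_linear_snd)
  have "((\<lambda>y. qcnj (snd y) \<odot> Nv y) has_derivative (\<lambda>X. qcnj (snd m) \<odot> dN m X + qcnj (snd X) \<odot> Nv m)) (at m)"
    by (rule qmult.FDERIV[OF q Nv_has_derivative[OF m]])
  from qmult.FDERIV[OF has_derivative_fst[OF has_derivative_ident] this]
  have 1: "((\<lambda>y. (1/2) *\<^sub>R (fst y \<odot> (qcnj (snd y) \<odot> Nv y))) has_derivative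
     (\<lambda>X. (1/2) *\<^sub>R (fst m \<odot> (qcnj (snd m) \<odot> dN m X + qcnj (snd X) \<odot> Nv m) + fst X \<odot> (qcnj (snd m) \<odot> Nv m)))) (at m)"
    by (rule has_derivative_scaleR_right)
  have "fst (frechet_derivative \<xi> (at m) X) = (1/2) *\<^sub>R (fst m \<odot> (qcnj (snd m) \<odot> dN m X + qcnj (snd X) \<odot> Nv m) + fst X \<odot> (qcnj (snd m) \<odot> Nv m))"
    by (rule tangent_space_derivative_unique[OF T has_derivative_fst[OF xi_has_derivative[OF m]] 1 open_UNIV])
       (auto simp: fst_xi)
  then show ?thesis by (simp add: qmult.add_right add_ac)
qed

lemma subspace_TM: "subspace (TM m)"
  by (auto simp: subspace_def TM_def inner_add_right)

lemma tproj_eqI: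
  assumes m: "m \<in> M" and w: "w \<in> TM m" and orth: "\<And>Z. Z \<in> TM m \<Longrightarrow> NKg m (v - w) Z = 0"
  shows "tproj M m v = w"
  unfolding tproj_def tangent_space_eq[OF m]
proof (rule the_equality)
  show "w \<in> TM m \<and> (\<forall>Z\<in>TM m. NKg m (v - w) Z = 0)" using w orth by blast
  fix w' assume w': "w' \<in> TM m \<and> (\<forall>Z\<in>TM m. NKg m (v - w') Z = 0)"
  have d: "w' - w \<in> TM m" using w w' subspace_TM subspace_diff by blast
  have "NKg m (w' - w) (w' - w) = 0"
    using orth[OF d] bspec[OF conjunct2[OF w'] d] by (simp add: NKg_diff_left)
  then show "w' = w" using NKg_pos[OF M_S3S3[OF m], of "w' - w"] by fastforce
qed

section \<open>Principal curvatures of the hypersurface from those of the surface\<close>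

text \<open>Translating \<open>v\<close> and the normal to the identity puts the problem in the form
  of \<open>shape_eigenvector_identity\<close>; the vector \<open>X\<close> built from
  \<open>u\<close> and \<open>v'\<close> is the eigenvector.\<close>

lemma principal_curvature_of_eigenvector:
  assumes m: "m \<in> M" and v: "v \<noteq> 0" "(0, v) \<in> TM m" "dN m (0, v) = - \<mu> *\<^sub>R v"
    and l: "l \<noteq> 0" "l\<^sup>2 - \<mu> * l - 1/12 = 0"
  shows "l \<in> principal_curvatures M \<xi> m"
proof -
  note un = unit_coords[OF m]
  note x = M_S3S3[OF m]
  define v' \<nu> where "v' = qcnj (snd m) \<odot> v" and "\<nu> = qcnj (snd m) \<odot> Nv m"
  define u where "u = (1/2) *\<^sub>R v' + (1 / (4 * l)) *\<^sub>R (v' \<odot> \<nu>)"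
  define X where "X = (fst m \<odot> u, snd m \<odot> v')"
  have vv: "snd m \<odot> v' = v" "snd m \<odot> \<nu> = Nv m" by (simp_all add: v'_def \<nu>_def un)
  have im: "qRe v' = 0" "qRe \<nu> = 0"
    using v(2) normal_unit[OF m] by (simp_all add: v'_def \<nu>_def qRe_qcnj_qmult TM_def)
  have \<nu>: "norm \<nu> = 1" by (simp add: \<nu>_def norm_qmult un normal_unit[OF m])
  have v\<nu>: "inner v' \<nu> = 0"
    using v(2) by (simp add: v'_def \<nu>_def inner_qmult_unit un TM_def inner_commute)
  have "qRe (v' \<odot> \<nu>) = 0"
    using qRe_qcnj_qmult[of v' \<nu>] im v\<nu> by (simp add: qcnj_imaginary qmult.minus_left qRe_eq_inner)
  then have iu: "qRe u = 0" using im by (simp add: u_def qRe_eq_inner inner_add)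
  have XT: "X \<in> TM m"
  proof -
    have "inner (fst m) (fst m \<odot> u) = 0"
      using inner_qmult_unit[OF un(1), of "qreal 1" u] iu by (simp add: qRe_eq_inner)
    then show ?thesis using v(2) by (simp add: X_def TM_def vv)
  qed
  have X0: "X \<noteq> 0" using v(1) by (simp add: X_def vv zero_prod_def)
  have dNX: "dN m X = - \<mu> *\<^sub>R v" using dN_eq_dN_snd[OF m XT] v(3) by (simp add: X_def vv)
  have \<xi>m: "\<xi> m = (fst m \<odot> ((1/2) *\<^sub>R \<nu>), snd m \<odot> \<nu>)"
    using fst_xi[OF m] by (simp add: prod_eq_iff[of "\<xi> m"] vv(2) qmult.scaleR_right Nv_def[symmetric] \<nu>_def[symmetric])
  have qcv: "qcnj v \<odot> Nv m = - (v' \<odot> \<nu>)"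
    unfolding vv(1)[symmetric] by (simp add: qcnj_qmult qmult_assoc \<nu>_def[symmetric] qcnj_imaginary im qmult.minus_left)
  have DX: "frechet_derivative \<xi> (at m) X =
     (fst m \<odot> ((1/2) *\<^sub>R (u \<odot> \<nu> - v' \<odot> \<nu> - \<mu> *\<^sub>R v')), snd m \<odot> (- \<mu> *\<^sub>R v'))"
  proof (rule prod_eqI)
    show "fst (frechet_derivative \<xi> (at m) X) = fst (fst m \<odot> ((1/2) *\<^sub>R (u \<odot> \<nu> - v' \<odot> \<nu> - \<mu> *\<^sub>R v')), snd m \<odot> (- \<mu> *\<^sub>R v'))"
      unfolding fst_derivative_xi[OF m XT] dNX
      by (simp add: X_def vv qcv \<nu>_def[symmetric] v'_def[symmetric] qmult_assoc qmult.scaleR_right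
          qmult.diff_right qmult.minus_right)
    show "snd (frechet_derivative \<xi> (at m) X) = snd (fst m \<odot> ((1/2) *\<^sub>R (u \<odot> \<nu> - v' \<odot> \<nu> - \<mu> *\<^sub>R v')), snd m \<odot> (- \<mu> *\<^sub>R v'))"
      using dNX by (simp add: dN_def qmult.scaleR_right qmult.minus_right vv)
  qed
  have "tproj M m (covd m \<xi> X) = - l *\<^sub>R X"
  proof (rule tproj_eqI[OF m])
    show "- l *\<^sub>R X \<in> TM m" using XT subspace_TM subspace_scale by blast
    fix Z assume Z: "Z \<in> TM m"
    define z w where "z = qcnj (fst m) \<odot> fst Z" and "w = qcnj (snd m) \<odot> snd Z"
    have zw: "Z = (fst m \<odot> z, snd m \<odot> w)" by (simp add: z_def w_def un)
    have izw: "qRe z = 0" "qRe w = 0" using Z by (auto simp: z_def w_def qRe_qcnj_qmult TM_def)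
    have "NKg m (covd m \<xi> X) Z = - l * NKg m X Z"
      unfolding covd_def NKg_add_left
      using shape_eigenvector_identity[OF x im(1) izw im(2) \<nu> v\<nu> l u_def]
      unfolding DX \<xi>m[symmetric] X_def[symmetric] zw[symmetric] .
    then show "NKg m (covd m \<xi> X - - l *\<^sub>R X) Z = 0"
      by (simp add: NKg_diff_left NKg_add_left NKg_scaleR_left)
  qed
  then have "shape_op M \<xi> m X = l *\<^sub>R X" by (simp add: shape_op_def)
  then show ?thesis unfolding principal_curvatures_def tangent_space_eq[OF m] using XT X0 by blast
qed

text \<open>The quadratic has positive discriminant \<mu>^2 + 1/3, and its constant term -1/12
  excludes the root 0.\<close>

lemma two_principal_curvatures_of_eigenvector:
  assumes m: "m \<in> M" and v: "v \<noteq> 0" "(0, v) \<in> TM m" "dN m (0, v) = - \<mu> *\<^sub>R v"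
  obtains l l' where "l \<noteq> l'" "l \<noteq> 0" "l' \<noteq> 0" "l\<^sup>2 - \<mu> * l - 1/12 = 0" "l'\<^sup>2 - \<mu> * l' - 1/12 = 0"
    "{l, l'} \<subseteq> principal_curvatures M \<xi> m"
proof -
  define d where "d = sqrt (\<mu>\<^sup>2 + 1/3)"
  have d: "d > 0" "d\<^sup>2 = \<mu>\<^sup>2 + 1/3" by (simp_all add: d_def add_nonneg_pos)
  have r: "((\<mu> + d) / 2)\<^sup>2 - \<mu> * ((\<mu> + d) / 2) - 1/12 = 0" "((\<mu> - d) / 2)\<^sup>2 - \<mu> * ((\<mu> - d) / 2) - 1/12 = 0"
    using d(2) by (simp_all add: field_simps power2_eq_square)
  then have n: "(\<mu> + d) / 2 \<noteq> 0" "(\<mu> - d) / 2 \<noteq> 0" by (auto simp: power2_eq_square)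
  show ?thesis
    using principal_curvature_of_eigenvector[OF m v n(1) r(1)]
      principal_curvature_of_eigenvector[OF m v n(2) r(2)] d(1)
    by (intro that[OF _ n r]) auto
qed

section \<open>Umbilicity and the small sphere\<close>

text \<open>If the symmetric operator on the plane orthogonal to q and N were not scalar, its two
  eigenvalues would yield two disjoint pairs of principal curvatures, four in total.\<close>

lemma umbilic:
  assumes m: "m \<in> M" and three: "card (principal_curvatures M \<xi> m) = 3"
  shows "\<exists>h. \<forall>X\<in>TM m. dN m X = - h *\<^sub>R snd X"
proof -
  obtain e1 where e1: "norm e1 = 1" "inner (snd m) e1 = 0" "inner (Nv m) e1 = 0"
    using exists_unit_orthogonal_quat[of "snd m" "Nv m" "Nv m"] by metis
  obtain e2 where e2: "norm e2 = 1" "inner (snd m) e2 = 0" "inner (Nv m) e2 = 0" "inner e1 e2 = 0"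
    using exists_unit_orthogonal_quat[of "snd m" "Nv m" e1] by metis
  note e = inner_self_unit[OF e1(1)] inner_self_unit[OF e2(1)]
  have e21: "inner e2 e1 = 0" using e2(4) by (simp add: inner_commute)
  have T: "(0, e1) \<in> TM m" "(0, e2) \<in> TM m" using e1 e2 by (auto simp: TM_def)
  define S where "S = (\<lambda>v. - dN m (0, v))"
  have S: "linear S"
    unfolding S_def
    by (intro linear_compose_neg linear_compose[of "\<lambda>v. (0, v)" "dN m", unfolded o_def] linear_dN[OF m])
       (simp add: linear_iff)
  have expand: "v = inner v e1 *\<^sub>R e1 + inner v e2 *\<^sub>R e2" if "inner (snd m) v = 0" "inner (Nv m) v = 0" for v
  proof -
    have comm: "inner v (snd m) = 0" "inner v (Nv m) = 0" "inner e1 (snd m) = 0" "inner e1 (Nv m) = 0"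
      "inner e2 (snd m) = 0" "inner e2 (Nv m) = 0"
      using that e1 e2 by (simp_all add: inner_commute)
    have "v - inner v e1 *\<^sub>R e1 - inner v e2 *\<^sub>R e2 = 0"
    proof (rule quat_eq_zero_if_orthogonal[of "snd m" "Nv m" e1 e2])
      show "snd m \<noteq> 0" "Nv m \<noteq> 0" "e1 \<noteq> 0" "e2 \<noteq> 0"
        using unit_coords[OF m] normal_unit[OF m] e1 e2 by auto
    qed (simp_all add: that e1 e2 e e21 comm normal_unit[OF m] inner_diff_left)
    then show ?thesis by (simp add: algebra_simps)
  qed
  define a b c where "a = inner (S e1) e1" and "b = inner (S e1) e2" and "c = inner (S e2) e2"
  have b': "inner (S e2) e1 = b"
    using dN_symmetric[OF m T] by (simp add: b_def S_def)
  have SE: "inner (snd m) (S v) = 0" "inner (Nv m) (S v) = 0" if "(0, v) \<in> TM m" for v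
    using dN_orthogonal[OF m that] by (simp_all add: S_def)
  have S1: "S e1 = a *\<^sub>R e1 + b *\<^sub>R e2" and S2: "S e2 = b *\<^sub>R e1 + c *\<^sub>R e2"
    using expand[OF SE[OF T(1)]] expand[OF SE[OF T(2)]] b' by (simp_all add: a_def b_def c_def)
  have "b = 0 \<and> a = c"
  proof (rule ccontr)
    assume "\<not> (b = 0 \<and> a = c)"
    then have non: "b \<noteq> 0 \<or> a \<noteq> c" by blast
    obtain \<mu>1 \<mu>2 v1 v2 where ev: "\<mu>1 \<noteq> \<mu>2" "v1 \<noteq> 0" "v2 \<noteq> 0" "S v1 = \<mu>1 *\<^sub>R v1" "S v2 = \<mu>2 *\<^sub>R v2"
      "v1 \<in> span {e1, e2}" "v2 \<in> span {e1, e2}"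
      by (rule symmetric_plane_operator[OF S e e2(4) S1 S2 non])
    have "subspace {v. (0, v) \<in> TM m}"
      by (auto simp: subspace_def TM_def inner_add_right)
    then have "span {e1, e2} \<subseteq> {v. (0, v) \<in> TM m}"
      using T by (intro span_minimal) auto
    then have vT: "(0, v1) \<in> TM m" "(0, v2) \<in> TM m" using ev by auto
    have dv: "dN m (0, v1) = - \<mu>1 *\<^sub>R v1" "dN m (0, v2) = - \<mu>2 *\<^sub>R v2"
      using ev(4,5) by (auto simp: S_def minus_equation_iff)
    obtain k1 k2 where k: "k1 \<noteq> k2" "k1 \<noteq> 0" "k2 \<noteq> 0" "k1\<^sup>2 - \<mu>1 * k1 - 1/12 = 0" "k2\<^sup>2 - \<mu>1 * k2 - 1/12 = 0"
      "{k1, k2} \<subseteq> principal_curvatures M \<xi> m"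
      by (rule two_principal_curvatures_of_eigenvector[OF m ev(2) vT(1) dv(1)])
    obtain l1 l2 where l: "l1 \<noteq> l2" "l1 \<noteq> 0" "l2 \<noteq> 0" "l1\<^sup>2 - \<mu>2 * l1 - 1/12 = 0" "l2\<^sup>2 - \<mu>2 * l2 - 1/12 = 0"
      "{l1, l2} \<subseteq> principal_curvatures M \<xi> m"
      by (rule two_principal_curvatures_of_eigenvector[OF m ev(3) vT(2) dv(2)])
    \<comment> \<open>Subtracting the two quadratics at a common root leaves (\<mu>1 - \<mu>2) times
      that root.\<close>
    have cross: "k \<noteq> l" if "k \<noteq> 0" "k\<^sup>2 - \<mu>1 * k - 1/12 = 0" "l\<^sup>2 - \<mu>2 * l - 1/12 = 0" for k l :: real
    proof
      assume "k = l"
      then have "(\<mu>1 - \<mu>2) * l = 0" using that(2,3) by (simp add: algebra_simps)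
      then show False using that(1) ev(1) \<open>k = l\<close> by simp
    qed
    have "card {k1, k2, l1, l2} = 4"
      using k(1) l(1) cross[OF k(2,4) l(4)] cross[OF k(2,4) l(5)] cross[OF k(3,5) l(4)] cross[OF k(3,5) l(5)] by simp
    \<comment> \<open>An infinite set has \<open>card\<close> 0, so cardinality 3 forces finiteness,
      as \<open>card_mono\<close> requires.\<close>
    moreover have "finite (principal_curvatures M \<xi> m)" using three by (simp add: card_ge_0_finite)
    then have "card {k1, k2, l1, l2} \<le> card (principal_curvatures M \<xi> m)"
      using k(6) l(6) by (intro card_mono) auto
    ultimately show False using three by simp
  qed
  then have Se: "S e1 = a *\<^sub>R e1" "S e2 = a *\<^sub>R e2" using S1 S2 by auto
  have "dN m X = - a *\<^sub>R snd X" if X: "X \<in> TM m" for X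
  proof -
    have xs: "snd X = inner (snd X) e1 *\<^sub>R e1 + inner (snd X) e2 *\<^sub>R e2"
      using X by (intro expand) (auto simp: TM_def)
    have "S (snd X) = inner (snd X) e1 *\<^sub>R S e1 + inner (snd X) e2 *\<^sub>R S e2"
      by (subst xs) (simp add: linear_add[OF S] linear_cmul[OF S])
    also have "\<dots> = a *\<^sub>R (inner (snd X) e1 *\<^sub>R e1 + inner (snd X) e2 *\<^sub>R e2)"
      by (simp add: Se scaleR_add_right mult.commute)
    finally have "S (snd X) = a *\<^sub>R snd X" using xs by simp
    then show ?thesis using dN_eq_dN_snd[OF m X] by (simp add: S_def minus_equation_iff)
  qed
  then show ?thesis by blast
qed

text \<open>Codazzi: by symmetry of \<open>dN\<close> the bracket of the extensions of \<open>X\<close> and \<open>Y\<close> vanishes at \<open>m\<close>, so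
  the commutator formula for \<open>dN(X) = - h X\<^sub>2\<close> leaves \<open>X(h) Y\<^sub>2 = Y(h) X\<^sub>2\<close>; take \<open>Y\<^sub>2 \<bottom> X\<^sub>2\<close> nonzero.\<close>

lemma curvature_stationary:
  assumes umb: "\<forall>y\<in>M. \<forall>X\<in>TM y. dN y X = - h y *\<^sub>R snd X" and m: "m \<in> M"
  shows "\<exists>U hh hh'. open U \<and> m \<in> U \<and> (\<forall>y\<in>M \<inter> U. h y = hh y) \<and>
    (hh has_derivative hh') (at m) \<and> (\<forall>X\<in>TM m. hh' X = 0)"
proof -
  have h: "dN y X = - h y *\<^sub>R snd X" if "y \<in> M" "X \<in> TM y" for y X using umb that by blast
  obtain W where W: "smooth_on W \<xi>" "open W" "M \<subseteq> W" by (rule smooth_near)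
  have mW: "m \<in> W" using W m by blast
  obtain w where w: "norm w = 1" "inner (snd m) w = 0" "inner (Nv m) w = 0"
    using exists_unit_orthogonal_quat[of "snd m" "Nv m" "Nv m"] by metis
  have wT: "(0, w) \<in> TM m" using w by (simp add: TM_def)
  \<comment> \<open>\<open>h\<close> is given only on \<open>M\<close>. Pairing the umbilic equation
    for an extended field with \<open>w\<close> and solving for \<open>h\<close> gives a quotient
    that is differentiable at \<open>m\<close>, where its denominator is 1.\<close>
  define hh where "hh = (\<lambda>y. - inner (dN y (ext_field (0, w) y)) w / inner (snd (ext_field (0, w) y)) w)"
  have D: "((\<lambda>y. dN y (ext_field (0, w) y)) has_derivative (\<lambda>X. snd (frechet_derivative (\<lambda>y. frechet_derivative \<xi> (at y) (ext_field (0, w) m)) (at m) X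
        + frechet_derivative \<xi> (at m) (ext_field_deriv m (0, w) X)))) (at m)"
    unfolding dN_def by (rule has_derivative_snd[OF has_derivative_along_field[OF W(1) mW ext_field_has_derivative[OF m wT]]])
  have fw: "((\<lambda>y. inner (snd (ext_field (0, w) y)) w) has_derivative (\<lambda>X. inner (snd (ext_field_deriv m (0, w) X)) w)) (at m)"
    by (intro has_derivative_inner_left has_derivative_snd ext_field_has_derivative[OF m wT])
  have ww: "inner (snd (ext_field (0, w) m)) w = 1" using w(1) by (simp add: ext_field_self[OF wT] norm_eq_1)
  have "hh differentiable (at m)"
    unfolding hh_def using ww
    by (intro differentiable_divide differentiable_minus differentiableI[OF has_derivative_inner_left[OF D]]
        differentiableI[OF fw]) simp
  then obtain hh' where hh': "(hh has_derivative hh') (at m)" by (auto simp: differentiable_def)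
  have "isCont (\<lambda>y. inner (snd (ext_field (0, w) y)) w) m" using fw by (rule has_derivative_continuous)
  then have "\<forall>\<^sub>F y in nhds m. inner (snd (ext_field (0, w) y)) w \<noteq> 0"
    using ww by (intro tendsto_imp_eventually_ne[where c = 1]) (auto simp: continuous_at tendsto_nhds_iff)
  then obtain U where U: "open U" "m \<in> U" "\<And>y. y \<in> U \<Longrightarrow> inner (snd (ext_field (0, w) y)) w \<noteq> 0"
    unfolding eventually_nhds by blast
  have eq: "h y = hh y" if "y \<in> M \<inter> U" for y
    using h[OF _ ext_field_in_TM, of y "(0, w)"] that U(3)[of y] by (simp add: hh_def)
  have "hh' X = 0" if X: "X \<in> TM m" for X
  proof -
    obtain w' where w': "norm w' = 1" "inner (snd m) w' = 0" "inner (Nv m) w' = 0" "inner (snd X) w' = 0"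
      using exists_unit_orthogonal_quat[of "snd m" "Nv m" "snd X"] by metis
    define Y :: pt where "Y = (0, w')"
    have Y: "Y \<in> TM m" using w' by (simp add: Y_def TM_def)
    have T: "X \<in> tangent_space M m" "Y \<in> tangent_space M m" using X Y tangent_space_eq[OF m] by auto
    note Xd = ext_field_has_derivative[OF m X] and Yd = ext_field_has_derivative[OF m Y]
    obtain A B where
      A: "((\<lambda>y. frechet_derivative \<xi> (at y) (ext_field Y y)) has_derivative A) (at m)" and
      B: "((\<lambda>y. frechet_derivative \<xi> (at y) (ext_field X y)) has_derivative B) (at m)" and
      AB: "A (ext_field X m) - B (ext_field Y m) = frechet_derivative \<xi> (at m) (ext_field_deriv m Y (ext_field X m) - ext_field_deriv m X (ext_field Y m))"
      by (rule derivative_along_fields_commutator[OF W(1) mW Yd Xd])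
    have sym: "ext_field_deriv m Y X - ext_field_deriv m X Y = 0"
      using dN_symmetric[OF m X Y] by (simp add: ext_field_deriv_def inner_commute prod_eq_iff)
    have hm: "((\<lambda>y. - hh y *\<^sub>R snd (ext_field Z y)) has_derivative
        (\<lambda>h. - hh m *\<^sub>R snd (ext_field_deriv m Z h) + (- hh' h) *\<^sub>R snd (ext_field Z m))) (at m)" if "Z \<in> TM m" for Z
      by (intro has_derivative_scaleR has_derivative_minus has_derivative_snd hh' ext_field_has_derivative[OF m that])
    have AX: "snd (A X) = - hh m *\<^sub>R snd (ext_field_deriv m Y X) + (- hh' X) *\<^sub>R snd (ext_field Y m)"
      by (rule tangent_space_derivative_unique[OF T(1) has_derivative_snd[OF A] hm[OF Y] U(1,2)])
         (use h[OF _ ext_field_in_TM] eq in \<open>auto simp: dN_def\<close>)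
    have BY: "snd (B Y) = - hh m *\<^sub>R snd (ext_field_deriv m X Y) + (- hh' Y) *\<^sub>R snd (ext_field X m)"
      by (rule tangent_space_derivative_unique[OF T(2) has_derivative_snd[OF B] hm[OF X] U(1,2)])
         (use h[OF _ ext_field_in_TM] eq in \<open>auto simp: dN_def\<close>)
    have "A X - B Y = 0"
      using AB sym linear_0[OF has_derivative_linear[OF xi_has_derivative[OF m]]]
      by (simp add: ext_field_self X Y)
    then have "snd (A X) = snd (B Y)" by simp
    then have "hh' X *\<^sub>R w' = hh' Y *\<^sub>R snd X"
      using AX BY sym by (simp add: ext_field_self X Y) (simp add: Y_def)
    then have "inner (hh' X *\<^sub>R w') w' = inner (hh' Y *\<^sub>R snd X) w'" by simp
    then show ?thesis using w'(1,4) by auto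
  qed
  then show ?thesis using U(1,2) eq hh' by blast
qed

text \<open>The vector C = N + h q is locally constant together with h. Pairing it with q gives h,
  and orthonormality of N and q gives its norm.\<close>

lemma locally_on_round_sphere:
  assumes three: "\<And>m. m \<in> M \<Longrightarrow> card (principal_curvatures M \<xi> m) = 3" and m: "m \<in> M"
  obtains U h C where "open U" "m \<in> U" "norm C = sqrt (1 + h\<^sup>2)" "\<And>y. y \<in> M \<inter> U \<Longrightarrow> inner C (snd y) = h"
proof -
  obtain h where h: "\<And>y X. y \<in> M \<Longrightarrow> X \<in> TM y \<Longrightarrow> dN y X = - h y *\<^sub>R snd X"
    using umbilic[OF _ three] by metis
  then have h': "\<forall>y\<in>M. \<forall>X\<in>TM y. dN y X = - h y *\<^sub>R snd X" by blast
  \<comment> \<open>The pair records \<open>h\<close> next to the centre vector, since the sphere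
    equation involves both as constants.\<close>
  define \<Psi> where "\<Psi> = (\<lambda>y. (h y, Nv y + h y *\<^sub>R snd y))"
  have sub: "submanifold5 M" using hyp by (simp add: hypersurface_with_normal_def)
  have "\<exists>U. open U \<and> m \<in> U \<and> (\<forall>y\<in>M \<inter> U. \<Psi> y = \<Psi> m)"
  proof (rule submanifold_locally_path_constant[OF sub m])
    fix I :: "real set" and \<gamma> t v
    assume I: "open I" "t \<in> I" "\<gamma> ` I \<subseteq> M" and \<gamma>: "(\<gamma> has_vector_derivative v) (at t)"
      and vT: "v \<in> tangent_space M (\<gamma> t)"
    have gM: "\<gamma> t \<in> M" using I by blast
    have v: "v \<in> TM (\<gamma> t)" using vT tangent_space_eq[OF gM] by simp
    \<comment> \<open>\<open>h\<close> is chosen point by point; near \<open>\<gamma> t\<close> it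
      is replaced by a function that agrees with it on \<open>M\<close> and is differentiable at
      \<open>\<gamma> t\<close>.\<close>
    obtain hh hh' U where U: "open U" "\<gamma> t \<in> U" "\<forall>y\<in>M \<inter> U. h y = hh y"
      "(hh has_derivative hh') (at (\<gamma> t))" "\<forall>X\<in>TM (\<gamma> t). hh' X = 0"
      using curvature_stationary[OF h' gM] by blast
    have \<gamma>d: "(\<gamma> has_derivative (\<lambda>s. s *\<^sub>R v)) (at t)" using \<gamma> by (simp add: has_vector_derivative_def)
    have "((\<lambda>s. hh (\<gamma> s)) has_derivative (\<lambda>s. hh' (s *\<^sub>R v))) (at t)"
      by (rule has_derivative_compose[OF \<gamma>d U(4)])
    then have hd: "((\<lambda>s. hh (\<gamma> s)) has_derivative (\<lambda>s. 0)) (at t)"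
      using bspec[OF U(5) v] by (simp add: linear_cmul[OF has_derivative_linear[OF U(4)]])
    have Nd: "((\<lambda>s. Nv (\<gamma> s)) has_derivative (\<lambda>s. s *\<^sub>R (- h (\<gamma> t) *\<^sub>R snd v))) (at t)"
      using has_derivative_compose[OF \<gamma>d Nv_has_derivative[OF gM]] h[OF gM v]
      by (simp add: linear_cmul[OF linear_dN[OF gM]])
    have eqt: "h (\<gamma> t) = hh (\<gamma> t)" using U gM by blast
    \<comment> \<open>Along the curve N contributes -h v_2 and h q contributes +h v_2; they cancel
      because \<open>h\<close> and \<open>hh\<close> agree at \<open>\<gamma> t\<close>.\<close>
    have "((\<lambda>s. (hh (\<gamma> s), Nv (\<gamma> s) + hh (\<gamma> s) *\<^sub>R snd (\<gamma> s))) has_derivative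
       (\<lambda>s. (0, s *\<^sub>R (- h (\<gamma> t) *\<^sub>R snd v) + (hh (\<gamma> t) *\<^sub>R snd (s *\<^sub>R v) + 0 *\<^sub>R snd (\<gamma> t))))) (at t)"
      by (intro has_derivative_Pair has_derivative_add has_derivative_scaleR has_derivative_snd hd Nd \<gamma>d)
    then have d0: "((\<lambda>s. (hh (\<gamma> s), Nv (\<gamma> s) + hh (\<gamma> s) *\<^sub>R snd (\<gamma> s))) has_derivative (\<lambda>s. 0)) (at t)"
      by (simp add: eqt mult.commute zero_prod_def)
    have "isCont \<gamma> t" using \<gamma> by (rule has_vector_derivative_continuous)
    then have "(\<gamma> \<longlongrightarrow> \<gamma> t) (at t)" by (simp add: isCont_def)
    then have "\<forall>\<^sub>F s in at t. \<gamma> s \<in> U" using U by (intro topological_tendstoD)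
    moreover have "\<forall>\<^sub>F s in at t. s \<in> I" using I by (intro eventually_at_in_open') auto
    ultimately have ev: "\<forall>\<^sub>F s in at t. (hh (\<gamma> s), Nv (\<gamma> s) + hh (\<gamma> s) *\<^sub>R snd (\<gamma> s)) = \<Psi> (\<gamma> s)"
    proof eventually_elim
      case (elim s)
      then have "h (\<gamma> s) = hh (\<gamma> s)" using U(3) I(3) by blast
      then show ?case by (simp add: \<Psi>_def)
    qed
    show "((\<lambda>s. \<Psi> (\<gamma> s)) has_vector_derivative 0) (at t)"
      unfolding has_vector_derivative_def scaleR_zero_right
      by (rule has_derivative_transform_eventually[OF d0 ev]) (simp_all add: \<Psi>_def eqt)
  qed
  then obtain U where U: "open U" "m \<in> U" "\<And>y. y \<in> M \<inter> U \<Longrightarrow> \<Psi> y = \<Psi> m" by blast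
  let ?C = "Nv m + h m *\<^sub>R snd m"
  show ?thesis
  proof (rule that[OF U(1,2)])
    show "norm ?C = sqrt (1 + (h m)\<^sup>2)"
      using unit_coords[OF m] normal_unit[OF m]
      by (simp add: norm_eq_sqrt_inner inner_add power2_eq_square)
    show "inner ?C (snd y) = h m" if y: "y \<in> M \<inter> U" for y
    proof -
      have yM: "y \<in> M" using y by blast
      have "h y = h m" "?C = Nv y + h y *\<^sub>R snd y" using U(3)[OF y] by (auto simp: \<Psi>_def)
      then show ?thesis using unit_coords[OF yM] normal_unit[OF yM] by (simp add: inner_add_left)
    qed
  qed
qed

end

section \<open>Rotation into the normal form\<close>

text \<open>Left multiplication by the conjugate of C/|C| sends C/|C| to 1, so the inner product
  with C becomes a multiple of the real part.\<close>

lemma small_sphere_rotation: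
  assumes C: "norm C = sqrt (1 + h\<^sup>2)"
  obtains b r where "b \<in> S3" "0 < r" "r \<le> 1"
    "\<And>q. norm q = 1 \<Longrightarrow> inner C q = h \<Longrightarrow> \<exists>y\<in>S2. b \<odot> q = qreal (sqrt (1 - r\<^sup>2)) + r *\<^sub>R y"
proof -
  have pos: "1 + h\<^sup>2 > 0" by (simp add: add_pos_nonneg)
  define n where "n = sqrt (1 + h\<^sup>2)"
  have n: "n > 0" "n\<^sup>2 = 1 + h\<^sup>2" using pos by (auto simp: n_def)
  \<comment> \<open>The sign makes the real part |h|/n nonnegative, as the square root in
    \<open>f_emb\<close> demands.\<close>
  define s :: real where "s = (if h \<ge> 0 then 1 else - 1)"
  define b where "b = (s / n) *\<^sub>R qcnj C"
  \<comment> \<open>A slice of the unit sphere at height |h|/n has radius sqrt(1 - h^2/n^2) =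
    1/n.\<close>
  define r where "r = 1 / n"
  have n1: "n \<ge> 1" by (simp add: n_def)
  have r: "0 < r" "r \<le> 1" using n n1 by (auto simp: r_def)
  have r2: "sqrt (1 - r\<^sup>2) = \<bar>h\<bar> / n"
  proof -
    have "1 - r\<^sup>2 = (\<bar>h\<bar> / n)\<^sup>2" using n pos by (simp add: r_def power_divide diff_divide_eq_iff)
    then show ?thesis using n by simp
  qed
  have nb: "norm b = 1" using C n by (simp add: b_def s_def n_def)
  show ?thesis
  proof (rule that[OF _ r])
    show "b \<in> S3" using nb by (simp add: S3_def)
    fix q assume q: "norm q = 1" "inner C q = h"
    define y where "y = (1 / r) *\<^sub>R (b \<odot> q - qreal (\<bar>h\<bar> / n))"
    have re: "inner (qreal 1) (b \<odot> q) = \<bar>h\<bar> / n"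
      using q(2) by (simp add: b_def qmult.scaleR_left qRe_eq_inner[symmetric] qRe_qcnj_qmult[symmetric] s_def)
         (simp add: qRe_eq_inner s_def)
    have qr: "qreal t = t *\<^sub>R qreal 1" for t by (simp add: quat_coords)
    have one: "inner (qreal 1) (qreal 1) = 1" by (simp add: quat_coords)
    have "qRe y = 0"
      using re one by (simp add: y_def qRe_eq_inner inner_diff_right qr[of "\<bar>h\<bar> / n"])
    moreover have "norm y = 1"
    proof -
      have bq: "inner (b \<odot> q) (b \<odot> q) = 1" using nb q by (simp add: norm_eq_1[symmetric] norm_qmult)
      have "inner (b \<odot> q - qreal (\<bar>h\<bar> / n)) (b \<odot> q - qreal (\<bar>h\<bar> / n)) = 1 - (\<bar>h\<bar> / n)\<^sup>2"
        unfolding qr[of "\<bar>h\<bar> / n"] using bq re one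
        by (simp add: inner_diff inner_commute power2_eq_square)
      also have "\<dots> = r\<^sup>2" using n pos by (simp add: r_def power_divide diff_divide_eq_iff)
      finally have "norm (b \<odot> q - qreal (\<bar>h\<bar> / n)) = r" using r by (simp add: norm_eq_sqrt_inner)
      then show ?thesis using r by (simp add: y_def)
    qed
    moreover have "b \<odot> q = qreal (sqrt (1 - r\<^sup>2)) + r *\<^sub>R y"
      using r unfolding r2 by (simp add: y_def)
    ultimately show "\<exists>y\<in>S2. b \<odot> q = qreal (sqrt (1 - r\<^sup>2)) + r *\<^sub>R y" unfolding S2_def by blast
  qed
qed

theorem theorem5p1:
  fixes M :: "pt set" and \<xi> :: "pt \<Rightarrow> pt"
  assumes hyp: "hypersurface_with_normal M \<xi>"
    and hopf: "is_Hopf M \<xi>"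
    and three: "\<forall>m\<in>M. card (principal_curvatures M \<xi> m) = 3"
    and Pinv: "\<forall>m\<in>M. NKP m ` Uperp M \<xi> m = Uperp M \<xi> m"
    and Pxi: "\<forall>m\<in>M. NKP m (\<xi> m) = (1/2) *\<^sub>R \<xi> m + (sqrt 3 / 2) *\<^sub>R NKJ m (\<xi> m)"
  shows "\<forall>m\<in>M. \<exists>W. open W \<and> m \<in> W \<and>
           (\<exists>a\<in>S3. \<exists>b\<in>S3. \<exists>c\<in>S3. \<exists>r. 0 < r \<and> r \<le> 1 \<and>
              Fabc a b c ` (M \<inter> W) \<subseteq> f_emb r ` (S3 \<times> S2))"
proof
  fix m assume m: "m \<in> M"
  interpret nk_hypersurface M \<xi> using hyp Pxi by unfold_locales auto
  obtain U h C where U: "open U" "m \<in> U" "norm C = sqrt (1 + h\<^sup>2)" "\<And>y. y \<in> M \<inter> U \<Longrightarrow> inner C (snd y) = h"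
    using locally_on_round_sphere[OF _ m] three by metis
  obtain b r where br: "b \<in> S3" "0 < r" "r \<le> 1"
    "\<And>q. norm q = 1 \<Longrightarrow> inner C q = h \<Longrightarrow> \<exists>y\<in>S2. b \<odot> q = qreal (sqrt (1 - r\<^sup>2)) + r *\<^sub>R y"
    by (rule small_sphere_rotation[OF U(3)]) blast
  have "norm (qreal 1) = 1" by (simp add: norm_eq_1 quat_coords)
  then have one: "qreal 1 \<in> S3" by (simp add: S3_def)
  \<comment> \<open>With a = c = 1 the first component stays fixed and serves as the parameter x of
    f_r; only the second component is rotated.\<close>
  have "Fabc (qreal 1) b (qreal 1) x \<in> f_emb r ` (S3 \<times> S2)" if x: "x \<in> M \<inter> U" for x
  proof -
    have xM: "x \<in> M" using x by blast
    obtain y where y: "y \<in> S2" "b \<odot> snd x = qreal (sqrt (1 - r\<^sup>2)) + r *\<^sub>R y"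
      using br(4)[OF unit_coords(2)[OF xM] U(4)[OF x]] by blast
    have "Fabc (qreal 1) b (qreal 1) x = f_emb r (fst x, y)"
      using y(2) by (simp add: Fabc_def f_emb_def)
    moreover have "(fst x, y) \<in> S3 \<times> S2" using y(1) unit_coords(1)[OF xM] by (simp add: S3_def)
    ultimately show ?thesis by blast
  qed
  then have "Fabc (qreal 1) b (qreal 1) ` (M \<inter> U) \<subseteq> f_emb r ` (S3 \<times> S2)" by blast
  with U(1,2) br(1,2,3) one
  show "\<exists>W. open W \<and> m \<in> W \<and> (\<exists>a\<in>S3. \<exists>b\<in>S3. \<exists>c\<in>S3. \<exists>r. 0 < r \<and> r \<le> 1 \<and>
              Fabc a b c ` (M \<inter> W) \<subseteq> f_emb r ` (S3 \<times> S2))"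
    by blast
qed

end
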